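(* Let $d\in\mathbb N$, $\omega(n)=(1+|n|)^s$, $n\in\mathbb Z^d$, with $s>(d+1)^2$. Let $\varphi\in W^1_\omega$ be continuous on $\mathbb R^d$, $\varphi_k=\varphi(\cdot-k)$, $\Phi=\{\varphi_k\}_{k\in\mathbb Z^d}$, and suppose that for every $q\in\{0\}\cup[1,\infty]$ there are $m_q,M_q>0$ with $m_q\|c\|_{\ell^q}\le\|\sum_{k}c_k\varphi_k\|_{L^q}\le M_q\|c\|_{\ell^q}$ for all $c\in\ell^q(\mathbb Z^d)$. Let $X=\{x_j:j\in\mathbb Z^d\}\subset\mathbb R^d$ be a separated set, i.e. $\inf_{j\ne k}|x_j-x_k|>0$, and suppose that for some $p\in[1,\infty]\cup\{0\}$ there are constants $a_p,b_p>0$ with $$a_p\|f\|_{L^p}\le\|\{f(x_j)\}_{j\in\mathbb Z^d}\|_{\ell^p}\le b_p\|f\|_{L^p}\quad\text{for all }f\in V^p(\Phi).$$ Then $X$ is a stable set of sampling on $V^q(\Phi)$ for all $q\in[1,\infty]\cup\{0\}$.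
   Context: $|\cdot|$ is the max-norm. All sequences are complex scalar. Convention for index $0$: $\ell^0$ means $\mathfrak c_0(\mathbb Z^d)$ (sequences tending to $0$ at infinity) with the sup-norm, and $L^0$-norm means the $L^\infty$-norm. $W^1_\omega$ is the space of measurable functions $\varphi$ on $\mathbb R^d$ with $\sum_{k\in\mathbb Z^d}\omega(k)\operatorname{ess\,sup}\{|\varphi(x+k)|:x\in[0,1]^d\}<\infty$. $V^p(\Phi)=\{\sum_{k\in\mathbb Z^d}c_k\varphi_k\}$, where $c=(c_k)$ ranges over $\ell^p(\mathbb Z^d)$ for $p\in[1,\infty]$ and over $\mathfrak c_0(\mathbb Z^d)$ for $p=0$. A set $X=\{x_j:j\in\mathbb Z^d\}$ is a (stable) set of sampling on $V^q(\Phi)$ if the sampling operator $(\mathbb Ac)(j)=\sum_{k\in\mathbb Z^d}c_k\varphi_k(x_j)$ (corresponding to the Dirac measures at the points $x_j$) is bounded $\ell^q(\mathbb Z^d)\to\ell^q(\mathbb Z^d)$ and bounded below, i.e. $\|\mathbb Ac\|_{\ell^q}\ge\kappa_q\|c\|_{\ell^q}$ for some $\kappa_q>0$ and all $c\in\ell^q(\mathbb Z^d)$. *)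

theory Defs
  imports "HOL-Probability.Essential_Supremum"
begin

text \<open>
  Exponents live in \<^typ>\<open>ennreal\<close>; the admissible ones are \<open>0\<close> and those in \<open>[1, \<infinity>]\<close>.
  The exponent \<open>0\<close> carries the supremum norm, and \<open>\<ell>\<^sup>0\<close> stands for the space of null sequences.
\<close>

definition admissible_exponent :: "ennreal \<Rightarrow> bool" where
  "admissible_exponent p \<longleftrightarrow> p = 0 \<or> 1 \<le> p"

text \<open>
  Norms are extended-valued, so that an upper bound on a norm entails its finiteness.
  The \<open>\<ell>\<^sup>p\<close> norm is the \<open>L\<^sup>p\<close> norm for the counting measure.
\<close>

definition Lp_norm :: "'a measure \<Rightarrow> ennreal \<Rightarrow> ('a \<Rightarrow> complex) \<Rightarrow> ennreal" where
  "Lp_norm M p f =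
    (if p = 0 \<or> p = \<infinity> then esssup M (\<lambda>x. ennreal (norm (f x)))
     else let r = enn2real p; I = (\<integral>\<^sup>+ x. ennreal (norm (f x) powr r) \<partial>M)
          in if I = \<infinity> then \<infinity> else ennreal (enn2real I powr (1 / r)))"

definition seq_norm :: "ennreal \<Rightarrow> ('i \<Rightarrow> complex) \<Rightarrow> ennreal" where
  "seq_norm p c = Lp_norm (count_space UNIV) p c"

lemma seq_norm_sup: "p = 0 \<or> p = \<infinity> \<Longrightarrow> seq_norm p c = (SUP k. ennreal (norm (c k)))"
proof -
  have "esssup (count_space UNIV) (\<lambda>k. ennreal (norm (c k))) = (SUP k. ennreal (norm (c k)))"
    by (subst esssup_eq_AE)
       (auto simp: AE_count_space intro!: antisym Inf_lower Inf_greatest SUP_upper SUP_least)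
  then show "p = 0 \<or> p = \<infinity> \<Longrightarrow> ?thesis"
    by (auto simp: seq_norm_def Lp_norm_def)
qed

text \<open>On \<open>\<int>\<^sup>d\<close>, tending to zero at infinity means tending to zero along the cofinite filter.\<close>

definition seq_space :: "ennreal \<Rightarrow> ('i \<Rightarrow> complex) set" where
  "seq_space p = (if p = 0 then {c. (c \<longlongrightarrow> 0) cofinite} else {c. seq_norm p c < \<infinity>})"

definition lattice_point :: "int ^ 'd \<Rightarrow> real ^ 'd" where
  "lattice_point k = (\<chi> i. real_of_int (k $ i))"

definition poly_weight :: "real \<Rightarrow> int ^ 'd \<Rightarrow> real" where
  "poly_weight s n = (1 + infnorm (lattice_point n)) powr s"

definition wiener_amalgam :: "(int ^ 'd \<Rightarrow> real) \<Rightarrow> (real ^ 'd \<Rightarrow> complex) set" where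
  "wiener_amalgam \<omega> = {\<phi>. \<phi> \<in> borel_measurable lebesgue \<and>
    (\<Sum>\<^sub>\<infinity>k. ennreal (\<omega> k) *
       esssup (lebesgue_on (cbox 0 1)) (\<lambda>x. ennreal (norm (\<phi> (x + lattice_point k))))) < \<infinity>}"

definition shifts :: "(real ^ 'd \<Rightarrow> complex) \<Rightarrow> int ^ 'd \<Rightarrow> real ^ 'd \<Rightarrow> complex" where
  "shifts \<phi> k = (\<lambda>x. \<phi> (x - lattice_point k))"

definition synthesis ::
  "(int ^ 'd \<Rightarrow> real ^ 'd \<Rightarrow> complex) \<Rightarrow> (int ^ 'd \<Rightarrow> complex) \<Rightarrow> real ^ 'd \<Rightarrow> complex" where
  "synthesis \<Phi> c = (\<lambda>x. \<Sum>\<^sub>\<infinity>k. c k * \<Phi> k x)"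

definition V_space ::
  "ennreal \<Rightarrow> (int ^ 'd \<Rightarrow> real ^ 'd \<Rightarrow> complex) \<Rightarrow> (real ^ 'd \<Rightarrow> complex) set" where
  "V_space p \<Phi> = synthesis \<Phi> ` seq_space p"

definition separated :: "(int ^ 'd \<Rightarrow> real ^ 'd) \<Rightarrow> bool" where
  "separated x \<longleftrightarrow> (INF (j, k) \<in> {(j, k). j \<noteq> k}. infnorm (x j - x k)) > 0"

definition sampling_operator ::
  "(int ^ 'd \<Rightarrow> real ^ 'd \<Rightarrow> complex) \<Rightarrow> (int ^ 'd \<Rightarrow> real ^ 'd) \<Rightarrow>
    (int ^ 'd \<Rightarrow> complex) \<Rightarrow> int ^ 'd \<Rightarrow> complex" where
  "sampling_operator \<Phi> x c = (\<lambda>j. \<Sum>\<^sub>\<infinity>k. c k * \<Phi> k (x j))"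

text \<open>
  The first conjunct says that the series defining the operator converge; it is needed because
  \<^const>\<open>infsum\<close> is \<open>0\<close> for families that are not summable.
\<close>

definition stable_sampling_set ::
  "ennreal \<Rightarrow> (int ^ 'd \<Rightarrow> real ^ 'd \<Rightarrow> complex) \<Rightarrow> (int ^ 'd \<Rightarrow> real ^ 'd) \<Rightarrow> bool" where
  "stable_sampling_set q \<Phi> x \<longleftrightarrow>
     (\<forall>c \<in> seq_space q. \<forall>j. (\<lambda>k. c k * \<Phi> k (x j)) summable_on UNIV) \<and>
     (\<forall>c \<in> seq_space q. sampling_operator \<Phi> x c \<in> seq_space q) \<and>
     (\<exists>K::real. \<forall>c \<in> seq_space q. seq_norm q (sampling_operator \<Phi> x c) \<le> ennreal K * seq_norm q c) \<and>
     (\<exists>\<kappa>::real. \<kappa> > 0 \<and>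
        (\<forall>c \<in> seq_space q. seq_norm q (sampling_operator \<Phi> x c) \<ge> ennreal \<kappa> * seq_norm q c))"

end

theory Submission
  imports Defs
begin

text \<open>
  Sampling at \<open>x j\<close> acts on coefficients through the matrix \<open>A j k = \<phi> (x j - k)\<close>. Let \<open>y j\<close> be the
  coordinatewise floor of \<open>x j\<close>. Membership of \<open>\<phi>\<close> in the Wiener amalgam space gives an envelope \<open>g\<close>
  with \<open>\<bar>A j k\<bar> \<le> g (y j - k)\<close> and with weighted sum \<open>\<Sum>l. (1 + \<bar>l\<bar>) powr s * g l\<close> finite
  (\<open>wiener_envelope\<close>). Separation bounds the number of rows with the same centre \<open>y j\<close>
  (\<open>separated_imp_bounded_multiplicity\<close>). Upper bounds for all exponents then follow from the Schur
  test (\<open>schur_test\<close>). For the exponent \<open>p\<close>, the stability of the generator and the sampling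
  inequality combine to a lower bound of \<open>A\<close> on sequences; it remains to transfer it to every other
  exponent.

  The transfer localizes with slowly varying weights. Put \<open>w k = (1 + \<epsilon> * \<bar>k\<bar>) powr - s\<close>, a
  summable function because \<open>s > d\<close>. Then
  \<open>\<bar>w (k - n) - w (m - n)\<bar> \<le> w (k - n) * ((1 + \<epsilon> * \<bar>m - k\<bar>) powr s - 1)\<close>, so the commutator of
  \<open>A\<close> with the multiplication by \<open>w (_ - n)\<close>, applied to \<open>c\<close>, is dominated by the kernel
  \<open>h l = g l * ((1 + \<epsilon> * \<bar>l\<bar>) powr s - 1)\<close> applied to \<open>v = w (_ - n) * c\<close>. By dominated convergence
  the sum of \<open>h\<close> tends to \<open>0\<close> with \<open>\<epsilon>\<close>. Hence for small \<open>\<epsilon>\<close> the commutator can be absorbed in the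
  lower bound for \<open>v\<close>, uniformly in \<open>n\<close>, and what remains is
  \<open>\<bar>c n\<bar> \<le> \<parallel>v\<parallel>\<^sub>p \<le> const * \<parallel>w (y _ - n) * A c\<parallel>\<^sub>p \<le> const * (\<Sum>j. w (y j - n) * \<bar>(A c) j\<bar>)\<close>
  for all bounded \<open>c\<close> and all \<open>n\<close> (\<open>localized_lower_bound\<close>). The right-hand side no longer mentions
  \<open>p\<close>: it is a matrix with bounded row and column sums applied to \<open>A c\<close>, so the Schur test gives
  \<open>\<parallel>c\<parallel>\<^sub>q \<le> const * \<parallel>A c\<parallel>\<^sub>q\<close> for every \<open>q\<close> (\<open>lower_bound_transfer\<close>).

  All sums of nonnegative terms are integrals with respect to counting measures, for which Tonelli's
  theorem and dominated convergence are at hand.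
\<close>

section \<open>Norms of sequences\<close>

lemma seq_norm_le_iff_sup:
  assumes "p = 0 \<or> p = \<infinity>"
  shows "seq_norm p c \<le> B \<longleftrightarrow> (\<forall>k. ennreal (norm (c k)) \<le> B)"
  using assms by (simp add: seq_norm_sup SUP_le_iff)

lemma seq_norm_le_iff_power:
  assumes "1 \<le> p" "p \<noteq> \<infinity>" "0 \<le> B"
  shows "seq_norm p c \<le> ennreal B \<longleftrightarrow>
    (\<integral>\<^sup>+k. ennreal (norm (c k) powr enn2real p) \<partial>count_space UNIV) \<le> ennreal (B powr enn2real p)"
proof -
  define r where "r = enn2real p"
  have r: "1 \<le> r"
    using assms enn2real_mono[of 1 p] by (simp add: r_def top.not_eq_extremum)
  define I where "I = (\<integral>\<^sup>+k. ennreal (norm (c k) powr r) \<partial>count_space UNIV)"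
  have *: "seq_norm p c = (if I = \<infinity> then \<infinity> else ennreal (enn2real I powr (1 / r)))"
    using assms unfolding seq_norm_def Lp_norm_def r_def I_def Let_def by auto
  show ?thesis
  proof (cases "I = \<infinity>")
    case True
    then show ?thesis
      using * by (simp add: I_def[symmetric] r_def[symmetric] top_unique)
  next
    case False
    then obtain t where t: "I = ennreal t" "0 \<le> t"
      by (cases I) auto
    have "t powr (1 / r) \<le> B \<longleftrightarrow> t \<le> B powr r"
    proof
      assume "t powr (1 / r) \<le> B"
      then have "(t powr (1 / r)) powr r \<le> B powr r"
        using r by (intro powr_mono2) auto
      then show "t \<le> B powr r"
        using r t by (simp add: powr_powr)
    next
      assume "t \<le> B powr r"
      then have "t powr (1 / r) \<le> (B powr r) powr (1 / r)"
        using r t by (intro powr_mono2) auto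
      then show "t powr (1 / r) \<le> B"
        using r assms by (simp add: powr_powr)
    qed
    then show ?thesis
      using * t assms False by (simp add: I_def[symmetric] r_def[symmetric])
  qed
qed

lemma admissible_exponent_cases [consumes 1, case_names sup power]:
  assumes "admissible_exponent p"
  obtains (sup) "p = 0 \<or> p = \<infinity>" | (power) "1 \<le> p" "p \<noteq> \<infinity>" "1 \<le> enn2real p"
proof (cases "p = 0 \<or> p = \<infinity>")
  case False
  then have "1 \<le> p" "p \<noteq> \<infinity>"
    using assms by (auto simp: admissible_exponent_def)
  moreover have "1 \<le> enn2real p"
    using calculation enn2real_mono[of 1 p] by (simp add: top.not_eq_extremum)
  ultimately show ?thesis by (rule power)
qed (rule sup)

lemma norm_le_seq_norm:
  assumes "admissible_exponent p"
  shows "ennreal (norm (c k)) \<le> seq_norm p c"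
using assms
proof (cases rule: admissible_exponent_cases)
  case sup
  then show ?thesis
    using seq_norm_le_iff_sup[of p c "seq_norm p c"] by blast
next
  case power
  show ?thesis
  proof (cases "seq_norm p c")
    case (real B)
    define r where "r = enn2real p"
    have "(\<integral>\<^sup>+k. ennreal (norm (c k) powr r) \<partial>count_space UNIV) \<le> ennreal (B powr r)"
      using seq_norm_le_iff_power[of p B c] power real by (simp add: r_def)
    then have "ennreal (norm (c k) powr r) \<le> ennreal (B powr r)"
      by (rule order_trans[OF nn_integral_ge_point[OF UNIV_I]])
    then have "norm (c k) powr r \<le> B powr r"
      by simp
    then have "norm (c k) \<le> B"
      using power real powr_less_mono2[of r B "norm (c k)"] by (force simp: r_def not_le[symmetric])
    then show ?thesis
      using real by simp
  qed simp
qed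

lemma seq_norm_le_sum:
  assumes "admissible_exponent p"
  shows "seq_norm p c \<le> (\<integral>\<^sup>+k. ennreal (norm (c k)) \<partial>count_space UNIV)" (is "_ \<le> ?S")
using assms
proof (cases rule: admissible_exponent_cases)
  case sup
  then show ?thesis
    by (auto simp: seq_norm_le_iff_sup intro: nn_integral_ge_point)
next
  case power
  show ?thesis
  proof (cases ?S)
    case (real B)
    define r where "r = enn2real p"
    have r: "1 \<le> r" using power by (simp add: r_def)
    have le: "norm (c k) \<le> B" for k
    proof -
      have "ennreal (norm (c k)) \<le> ?S"
        by (rule nn_integral_ge_point) simp
      then show ?thesis using real by simp
    qed
    have "norm (c k) powr r \<le> B powr (r - 1) * norm (c k)" for k
    proof -
      have "norm (c k) powr r = norm (c k) powr (r - 1) * norm (c k)"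
        by (metis add.commute diff_add_cancel norm_ge_zero powr_mult_base mult.commute)
      also have "\<dots> \<le> B powr (r - 1) * norm (c k)"
        using r le[of k] by (intro mult_right_mono powr_mono2) auto
      finally show ?thesis .
    qed
    then have "(\<integral>\<^sup>+k. ennreal (norm (c k) powr r) \<partial>count_space UNIV)
        \<le> (\<integral>\<^sup>+k. ennreal (B powr (r - 1)) * ennreal (norm (c k)) \<partial>count_space UNIV)"
      by (intro nn_integral_mono) (simp add: ennreal_mult'[symmetric])
    also have "\<dots> = ennreal (B powr (r - 1)) * ennreal B"
      by (simp add: nn_integral_cmult real)
    also have "\<dots> = ennreal (B powr r)"
      using real by (metis add.commute diff_add_cancel ennreal_mult' powr_ge_zero powr_mult_base mult.commute)
    finally show ?thesis
      using seq_norm_le_iff_power[of p B c] power real by (simp add: r_def)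
  qed simp
qed

text \<open>
  The constant \<open>2\<close> replaces Minkowski's inequality by the trivial bound of a sum by twice the larger
  summand; the absorption argument below tolerates any fixed constant.
\<close>

lemma seq_norm_quasi_triangle:
  assumes "admissible_exponent p" and "\<And>k. norm (f k) \<le> norm (g k) + norm (h k)"
  shows "seq_norm p f \<le> 2 * (seq_norm p g + seq_norm p h)"
proof (cases "seq_norm p g = \<infinity> \<or> seq_norm p h = \<infinity>")
  case True
  then show ?thesis by (auto simp: ennreal_mult_top)
next
  case False
  then obtain G H where GH: "seq_norm p g = ennreal G" "0 \<le> G" "seq_norm p h = ennreal H" "0 \<le> H"
    by (metis ennreal_cases infinity_ennreal_def)
  have rhs: "2 * (seq_norm p g + seq_norm p h) = ennreal (2 * (G + H))"
    using GH by (simp add: distrib_left numeral_mult_ennreal del: ennreal_plus flip: ennreal_plus)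
  show ?thesis
  using assms(1)
  proof (cases rule: admissible_exponent_cases)
    case sup
    have "norm (g k) \<le> G" "norm (h k) \<le> H" for k
      using norm_le_seq_norm[OF assms(1), of g k] norm_le_seq_norm[OF assms(1), of h k] GH by auto
    then have "norm (f k) \<le> 2 * (G + H)" for k
      using assms(2)[of k] GH by (smt (verit, best))
    then show ?thesis
      unfolding rhs seq_norm_le_iff_sup[OF sup] by (simp add: ennreal_leI)
  next
    case power
    define r where "r = enn2real p"
    have r: "1 \<le> r" using power by (simp add: r_def)
    have I: "(\<integral>\<^sup>+k. ennreal (norm (g k) powr r) \<partial>count_space UNIV) \<le> ennreal (G powr r)"
      "(\<integral>\<^sup>+k. ennreal (norm (h k) powr r) \<partial>count_space UNIV) \<le> ennreal (H powr r)"
      using seq_norm_le_iff_power[of p G g] seq_norm_le_iff_power[of p H h] power GH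
      by (simp_all add: r_def)
    have pt: "norm (f k) powr r \<le> 2 powr r * (norm (g k) powr r + norm (h k) powr r)" for k
    proof -
      have "norm (f k) powr r \<le> (2 * max (norm (g k)) (norm (h k))) powr r"
        using assms(2)[of k] r by (intro powr_mono2) auto
      also have "\<dots> = 2 powr r * max (norm (g k)) (norm (h k)) powr r"
        by (simp add: powr_mult)
      also have "\<dots> \<le> 2 powr r * (norm (g k) powr r + norm (h k) powr r)"
        by (intro mult_left_mono) (auto simp: max_def)
      finally show ?thesis .
    qed
    have "G powr r + H powr r \<le> (G + H) powr r"
    proof -
      have eq: "t powr r = t powr (r - 1) * t" if "0 \<le> t" for t :: real
        using that by (metis add.commute diff_add_cancel powr_mult_base mult.commute)
      have "G powr (r - 1) * G + H powr (r - 1) * H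
          \<le> (G + H) powr (r - 1) * G + (G + H) powr (r - 1) * H"
        using GH r by (intro add_mono mult_right_mono powr_mono2) auto
      then show ?thesis
        using GH by (simp add: eq algebra_simps)
    qed
    then have GHr: "2 powr r * (G powr r + H powr r) \<le> (2 * (G + H)) powr r"
      unfolding powr_mult by (rule mult_left_mono) simp
    have "(\<integral>\<^sup>+k. ennreal (norm (f k) powr r) \<partial>count_space UNIV)
        \<le> (\<integral>\<^sup>+k. ennreal (2 powr r) * (ennreal (norm (g k) powr r) + ennreal (norm (h k) powr r))
            \<partial>count_space UNIV)"
      using pt by (intro nn_integral_mono) (simp add: ennreal_mult'[symmetric] flip: ennreal_plus)
    also have "\<dots> \<le> ennreal (2 powr r) * (ennreal (G powr r) + ennreal (H powr r))"
      using I by (auto simp: nn_integral_cmult nn_integral_add intro!: mult_left_mono add_mono)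
    also have "\<dots> \<le> ennreal ((2 * (G + H)) powr r)"
      using GHr by (simp add: ennreal_mult'[symmetric] flip: ennreal_plus)
    finally show ?thesis
      using seq_norm_le_iff_power[of p "2 * (G + H)" f] power GH unfolding rhs by (simp add: r_def)
  qed
qed

section \<open>The Schur test\<close>

text \<open>
  Jensen's inequality for the measure \<open>b\<close> of mass at most \<open>K\<close>, up to the factor \<open>2\<close> inside the power.
  With \<open>t = S / (2 * K)\<close>, the values \<open>y k \<le> t\<close> contribute at most \<open>t * K\<close>, which is half of \<open>S\<close>; so
  the other half comes from values above \<open>t\<close>, where \<open>y k \<le> t powr (1 - r) * y k powr r\<close>. Losing
  a constant avoids a separate treatment of the mass of \<open>b\<close>, which need not be exactly \<open>K\<close>.
\<close>

lemma weighted_power_mean: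
  fixes b :: "'k \<Rightarrow> ennreal" and y :: "'k \<Rightarrow> real"
  assumes r: "1 \<le> r" and K: "0 < K" and S: "0 \<le> S" and y: "\<And>k. 0 \<le> y k"
    and b: "(\<integral>\<^sup>+k. b k \<partial>count_space UNIV) \<le> ennreal K"
    and le: "ennreal S \<le> (\<integral>\<^sup>+k. b k * ennreal (y k) \<partial>count_space UNIV)"
  shows "ennreal (K * (S / (2 * K)) powr r)
    \<le> (\<integral>\<^sup>+k. b k * ennreal (y k powr r) \<partial>count_space UNIV)" (is "_ \<le> ?T")
proof (cases "S = 0 \<or> ?T = \<infinity>")
  case True
  then show ?thesis by auto
next
  case False
  define t where "t = S / (2 * K)"
  have t: "0 < t" using False S K by (simp add: t_def)
  obtain T where T: "?T = ennreal T" "0 \<le> T"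
    using False by (cases ?T) auto
  have young: "y k \<le> t + t powr (1 - r) * y k powr r" for k
  proof (cases "y k \<le> t")
    case False
    then have "1 \<le> (y k / t) powr (r - 1)"
      using r t by (intro ge_one_powr_ge_zero) auto
    then have "y k \<le> (y k / t) powr (r - 1) * y k"
      using y[of k] by (simp add: mult_le_cancel_right1)
    also have "\<dots> = t powr (1 - r) * y k powr r"
      using False t by (simp add: powr_divide powr_diff field_simps)
    finally show ?thesis using t by simp
  qed (simp add: add_increasing2)
  have "ennreal S \<le> (\<integral>\<^sup>+k. ennreal t * b k + ennreal (t powr (1 - r)) * (b k * ennreal (y k powr r))
      \<partial>count_space UNIV)"
  proof (rule order_trans[OF le], rule nn_integral_mono)
    fix k
    have "b k * ennreal (y k) \<le> b k * ennreal (t + t powr (1 - r) * y k powr r)"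
      using young[of k] by (intro mult_left_mono ennreal_leI) auto
    then show "b k * ennreal (y k)
        \<le> ennreal t * b k + ennreal (t powr (1 - r)) * (b k * ennreal (y k powr r))"
      using t by (simp add: ennreal_plus ennreal_mult' distrib_left mult_ac)
  qed
  also have "\<dots> \<le> ennreal t * ennreal K + ennreal (t powr (1 - r)) * ennreal T"
    using b T by (auto simp: nn_integral_add nn_integral_cmult intro!: mult_left_mono add_mono)
  also have "\<dots> = ennreal (t * K + t powr (1 - r) * T)"
    using t T K by (simp add: ennreal_mult')
  finally have "S \<le> t * K + t powr (1 - r) * T"
    using t T K by (simp add: add_nonneg_nonneg del: ennreal_plus)
  then have "t * K \<le> t powr (1 - r) * T"
    using K by (simp add: t_def field_simps)
  then have "t powr (r - 1) * (t * K) \<le> t powr (r - 1) * (t powr (1 - r) * T)"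
    by (intro mult_left_mono) auto
  moreover have "t powr (r - 1) * (t * K) = K * t powr r"
    using t by (simp add: powr_diff)
  moreover have "t powr (r - 1) * (t powr (1 - r) * T) = T"
    using t by (simp add: powr_diff)
  ultimately have "K * t powr r \<le> T"
    by simp
  then show ?thesis
    using T by (simp add: t_def ennreal_leI)
qed

lemma nn_integral_count_space_swap:
  fixes F :: "'j \<Rightarrow> 'k \<Rightarrow> ennreal"
  shows "(\<integral>\<^sup>+j. \<integral>\<^sup>+k. F j k \<partial>count_space UNIV \<partial>count_space UNIV)
    = (\<integral>\<^sup>+k. \<integral>\<^sup>+j. F j k \<partial>count_space UNIV \<partial>count_space UNIV)"
  using nn_integral_fst_count_space[of "case_prod F"] nn_integral_snd_count_space[of "case_prod F"]
  by simp

text \<open>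
  For finite exponents, \<open>weighted_power_mean\<close> bounds the power of each entry of \<open>f\<close> by a row sum of
  powers of \<open>c\<close>. Summing over the rows and exchanging the sums leaves column sums. The constant is
  the same for all exponents and proportional to \<open>K\<close>, so it is small when the matrix is small.
\<close>

lemma schur_test:
  fixes b :: "'j \<Rightarrow> 'k \<Rightarrow> ennreal"
  assumes p: "admissible_exponent p" and K: "0 < K"
    and rows: "\<And>j. (\<integral>\<^sup>+k. b j k \<partial>count_space UNIV) \<le> ennreal K"
    and cols: "\<And>k. (\<integral>\<^sup>+j. b j k \<partial>count_space UNIV) \<le> ennreal K"
    and f: "\<And>j. ennreal (norm (f j)) \<le> (\<integral>\<^sup>+k. b j k * ennreal (norm (c k)) \<partial>count_space UNIV)"
  shows "seq_norm p f \<le> ennreal (2 * K) * seq_norm p c"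
proof (cases "seq_norm p c")
  case (real C)
  have rhs: "ennreal (2 * K) * seq_norm p c = ennreal (2 * K * C)"
    using real K by (simp add: ennreal_mult')
  show ?thesis
  using p
  proof (cases rule: admissible_exponent_cases)
    case sup
    have "ennreal (norm (f j)) \<le> ennreal (2 * K * C)" for j
    proof -
      have "ennreal (norm (f j)) \<le> (\<integral>\<^sup>+k. b j k * ennreal C \<partial>count_space UNIV)"
        using norm_le_seq_norm[OF p, of c] real
        by (intro order_trans[OF f] nn_integral_mono mult_left_mono) auto
      also have "\<dots> \<le> ennreal K * ennreal C"
        using rows[of j] by (auto simp: nn_integral_multc intro!: mult_right_mono)
      also have "\<dots> \<le> ennreal (2 * K * C)"
        using K real by (simp add: ennreal_mult'[symmetric] mult_right_mono)
      finally show ?thesis .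
    qed
    then show ?thesis
      unfolding rhs seq_norm_le_iff_sup[OF sup] by simp
  next
    case power
    define r where "r = enn2real p"
    have r: "1 \<le> r" using power by (simp add: r_def)
    have c: "(\<integral>\<^sup>+k. ennreal (norm (c k) powr r) \<partial>count_space UNIV) \<le> ennreal (C powr r)"
      using seq_norm_le_iff_power[of p C c] power real by (simp add: r_def)
    have "(\<integral>\<^sup>+j. ennreal (K * (norm (f j) / (2 * K)) powr r) \<partial>count_space UNIV)
        \<le> (\<integral>\<^sup>+j. \<integral>\<^sup>+k. b j k * ennreal (norm (c k) powr r) \<partial>count_space UNIV \<partial>count_space UNIV)"
      using r K rows f by (intro nn_integral_mono weighted_power_mean) auto
    also have "\<dots> = (\<integral>\<^sup>+k. (\<integral>\<^sup>+j. b j k \<partial>count_space UNIV) * ennreal (norm (c k) powr r)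
        \<partial>count_space UNIV)"
      by (subst nn_integral_count_space_swap) (simp add: nn_integral_multc)
    also have "\<dots> \<le> (\<integral>\<^sup>+k. ennreal K * ennreal (norm (c k) powr r) \<partial>count_space UNIV)"
      by (intro nn_integral_mono mult_right_mono cols) auto
    also have "\<dots> \<le> ennreal K * ennreal (C powr r)"
      using c by (auto simp: nn_integral_cmult intro!: mult_left_mono)
    finally have I: "(\<integral>\<^sup>+j. ennreal (K * (norm (f j) / (2 * K)) powr r) \<partial>count_space UNIV)
        \<le> ennreal (K * C powr r)"
      using K by (simp add: ennreal_mult')
    have "norm (f j) powr r = (2 * K) powr r / K * (K * (norm (f j) / (2 * K)) powr r)" for j
      using K by (simp add: powr_divide)
    then have "(\<integral>\<^sup>+j. ennreal (norm (f j) powr r) \<partial>count_space UNIV)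
        = ennreal ((2 * K) powr r / K)
          * (\<integral>\<^sup>+j. ennreal (K * (norm (f j) / (2 * K)) powr r) \<partial>count_space UNIV)"
      using K by (subst nn_integral_cmult[symmetric]) (auto simp: ennreal_mult'[symmetric])
    also have "\<dots> \<le> ennreal ((2 * K) powr r / K) * ennreal (K * C powr r)"
      by (intro mult_left_mono I) simp
    also have "\<dots> = ennreal ((2 * K * C) powr r)"
      using K real by (simp add: ennreal_mult'[symmetric] powr_mult)
    finally show ?thesis
      using seq_norm_le_iff_power[of p "2 * K * C" f] power K real unfolding rhs by (simp add: r_def)
  qed
qed (use K in \<open>simp add: ennreal_mult_top\<close>)

section \<open>Summable, null and bounded sequences\<close>

lemma summable_imp_null:
  assumes "(\<integral>\<^sup>+k. ennreal (norm (c k)) \<partial>count_space UNIV) < \<infinity>"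
  shows "(c \<longlongrightarrow> (0::complex)) cofinite"
proof (rule tendstoI)
  fix e :: real assume e: "0 < e"
  have "finite {k. e \<le> norm (c k)}"
  proof (rule ccontr)
    assume inf: "infinite {k. e \<le> norm (c k)}"
    have "(\<integral>\<^sup>+k. ennreal e * indicator {k. e \<le> norm (c k)} k \<partial>count_space UNIV)
        \<le> (\<integral>\<^sup>+k. ennreal (norm (c k)) \<partial>count_space UNIV)"
      by (intro nn_integral_mono) (auto simp: indicator_def ennreal_leI)
    moreover have "(\<integral>\<^sup>+k. ennreal e * indicator {k. e \<le> norm (c k)} k \<partial>count_space UNIV) = \<infinity>"
      using inf e by (simp add: nn_integral_cmult_indicator ennreal_mult_top)
    ultimately show False using assms by simp
  qed
  then show "\<forall>\<^sub>F k in cofinite. dist (c k) 0 < e"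
    by (simp add: eventually_cofinite not_less)
qed

lemma summable_in_seq_space:
  assumes "admissible_exponent p" "(\<integral>\<^sup>+k. ennreal (norm (c k)) \<partial>count_space UNIV) < \<infinity>"
  shows "c \<in> seq_space p"
  using assms seq_norm_le_sum[of p c] summable_imp_null[of c] by (auto simp: seq_space_def)

lemma seq_space_bounded:
  assumes p: "admissible_exponent p" and c: "c \<in> seq_space p"
  obtains B where "0 \<le> B" "\<And>k. norm (c k) \<le> B"
proof (cases "p = 0")
  case True
  then have "\<forall>\<^sub>F k in cofinite. dist (c k) 0 < 1"
    using c by (intro tendstoD) (auto simp: seq_space_def)
  then have fin: "finite {k. \<not> norm (c k) < 1}"
    by (simp add: eventually_cofinite)
  show ?thesis
  proof
    show "norm (c k) \<le> 1 + (\<Sum>k\<in>{k. \<not> norm (c k) < 1}. norm (c k))" for k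
    proof (cases "norm (c k) < 1")
      case True
      then show ?thesis
        using sum_nonneg[of "{k. \<not> norm (c k) < 1}" "\<lambda>k. norm (c k)"] by simp
    next
      case False
      then show ?thesis
        using member_le_sum[of k "{k. \<not> norm (c k) < 1}" "\<lambda>k. norm (c k)"] fin by simp
    qed
  qed (auto intro!: add_nonneg_nonneg sum_nonneg)
next
  case False
  then obtain B where "seq_norm p c = ennreal B" "0 \<le> B"
    using c by (cases "seq_norm p c") (auto simp: seq_space_def)
  with norm_le_seq_norm[OF p, of c] show ?thesis
    by (intro that[of B]) auto
qed

text \<open>
  This connects the unconditional sums that define the operators with the nonnegative integrals in
  which all estimates are carried out.
\<close>

lemma infsum_nn_bound:
  fixes f :: "'k \<Rightarrow> complex"
  assumes "(\<integral>\<^sup>+k. ennreal (norm (f k)) \<partial>count_space UNIV) < \<infinity>"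
  shows "f summable_on UNIV"
    and "ennreal (norm (infsum f UNIV)) \<le> (\<integral>\<^sup>+k. ennreal (norm (f k)) \<partial>count_space UNIV)"
proof -
  have int: "integrable (count_space UNIV) f"
    using assms by (intro integrableI_bounded) auto
  then have abs: "Infinite_Set_Sum.abs_summable_on f UNIV"
    by (simp add: Infinite_Set_Sum.abs_summable_on_def)
  then have "Infinite_Sum.abs_summable_on f UNIV"
    by (simp add: abs_summable_equivalent)
  then show "f summable_on UNIV"
    by (rule abs_summable_summable)
  show "ennreal (norm (infsum f UNIV)) \<le> (\<integral>\<^sup>+k. ennreal (norm (f k)) \<partial>count_space UNIV)"
    using integral_norm_bound_ennreal[OF int] infsetsum_infsum[OF abs]
    by (simp add: infsetsum_def)
qed

section \<open>Polynomial weights on the lattice\<close>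

lemma lattice_point_diff: "lattice_point (m - n) = lattice_point m - lattice_point n"
  by (simp add: lattice_point_def vec_eq_iff)

lemma summable_int_powr:
  assumes "1 < t"
  shows "integrable (count_space UNIV) (\<lambda>m::int. (1 + \<bar>real_of_int m\<bar>) powr - t)"
proof -
  let ?f = "\<lambda>m::int. (1 + \<bar>real_of_int m\<bar>) powr - t"
  have "summable (\<lambda>n. real (Suc n) powr - t)"
    using assms by (subst summable_Suc_iff) (simp add: summable_real_powr_iff)
  then have nat: "Infinite_Set_Sum.abs_summable_on (\<lambda>n. (1 + real n) powr - t) UNIV"
    by (simp add: abs_summable_on_nat_iff' add.commute)
  have "Infinite_Set_Sum.abs_summable_on ?f (range int)"
    using nat by (subst abs_summable_on_reindex_iff[symmetric]) auto
  moreover have "Infinite_Set_Sum.abs_summable_on ?f (range (\<lambda>n. - int n))"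
    using nat by (subst abs_summable_on_reindex_iff[symmetric]) (auto simp: inj_def)
  ultimately have "Infinite_Set_Sum.abs_summable_on ?f (range int \<union> range (\<lambda>n. - int n))"
    by (rule abs_summable_on_union)
  moreover have "range int \<union> range (\<lambda>n. - int n) = UNIV"
    by (auto simp: image_iff) (metis int_cases2)
  ultimately show ?thesis
    by (simp add: Infinite_Set_Sum.abs_summable_on_def)
qed

text \<open>
  The maximum norm dominates every coordinate, so with \<open>t = s / d > 1\<close> the function
  \<open>(1 + \<bar>k\<bar>) powr - s\<close> is at most the product over the \<open>d\<close> coordinates of \<open>(1 + \<bar>k $ i\<bar>) powr - t\<close>.
  The sum of such a product over the lattice factorizes into one-dimensional convergent series.
\<close>

lemma summable_inverse_poly_weight:
  assumes "real CARD('d) < s"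
  shows "(\<integral>\<^sup>+(k::int^'d). ennreal (1 / poly_weight s k) \<partial>count_space UNIV) < \<infinity>"
proof -
  define t where "t = s / real CARD('d)"
  have t: "1 < t" using assms by (simp add: t_def)
  define f where "f m = (1 + \<bar>real_of_int m\<bar>) powr - t" for m :: int
  have le: "1 / poly_weight s k \<le> (\<Prod>i\<in>UNIV. f (k $ i))" for k :: "int^'d"
  proof -
    define N where "N = infnorm (lattice_point k)"
    have N: "0 \<le> N" by (simp add: N_def infnorm_pos_le)
    have "1 / poly_weight s k = (1 + N) powr - s"
      by (simp add: poly_weight_def N_def powr_minus_divide)
    also have "\<dots> = ((1 + N) powr - t) ^ CARD('d)"
      using N assms by (simp add: powr_power t_def)
    also have "\<dots> = (\<Prod>i::'d\<in>UNIV. (1 + N) powr - t)"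
      by simp
    also have "\<dots> \<le> (\<Prod>i\<in>UNIV. f (k $ i))"
    proof (intro prod_mono conjI)
      fix i
      have "\<bar>real_of_int (k $ i)\<bar> \<le> N"
        using component_le_infnorm_cart[of "lattice_point k" i] by (simp add: N_def lattice_point_def)
      then show "(1 + N) powr - t \<le> f (k $ i)"
        unfolding f_def using t by (intro powr_mono2') auto
    qed simp
    finally show ?thesis .
  qed
  have "Infinite_Set_Sum.abs_summable_on (\<lambda>g. \<Prod>i\<in>UNIV. f (g i)) (PiE (UNIV::'d set) (\<lambda>_. UNIV))"
    using summable_int_powr[OF t]
    by (intro abs_summable_on_prod_PiE) (simp_all add: Infinite_Set_Sum.abs_summable_on_def f_def[abs_def])
  then have "integrable (count_space UNIV) (\<lambda>g. \<Prod>i::'d\<in>UNIV. f (g i))"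
    by (simp add: Infinite_Set_Sum.abs_summable_on_def)
  then have fin: "(\<integral>\<^sup>+g. ennreal (\<Prod>i::'d\<in>UNIV. f (g i)) \<partial>count_space UNIV) < \<infinity>"
    by (simp add: integrable_iff_bounded f_def prod_nonneg)
  have bij: "bij_betw (vec_nth :: int^'d \<Rightarrow> _) UNIV UNIV"
    by (rule bij_betwI[of _ _ _ vec_lambda]) auto
  have "(\<integral>\<^sup>+(k::int^'d). ennreal (1 / poly_weight s k) \<partial>count_space UNIV)
      \<le> (\<integral>\<^sup>+(k::int^'d). ennreal (\<Prod>i\<in>UNIV. f (k $ i)) \<partial>count_space UNIV)"
    by (intro nn_integral_mono ennreal_leI le)
  also have "\<dots> = (\<integral>\<^sup>+g. ennreal (\<Prod>i::'d\<in>UNIV. f (g i)) \<partial>count_space UNIV)"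
    by (rule nn_integral_bij_count_space[OF bij])
  finally show ?thesis
    using fin by simp
qed

text \<open>
  The weight \<open>poly_weight s\<close> is the case \<open>\<epsilon> = 1\<close>. As \<open>\<epsilon>\<close> decreases to \<open>0\<close>, the weight flattens to the
  constant \<open>1\<close>, while its reciprocal stays summable for every \<open>\<epsilon> > 0\<close>.
\<close>

definition dilated_weight :: "real \<Rightarrow> real \<Rightarrow> int^'d \<Rightarrow> real" where
  "dilated_weight \<epsilon> s k = (1 + \<epsilon> * infnorm (lattice_point k)) powr s"

lemma dilated_weight_ge_one: "0 \<le> \<epsilon> \<Longrightarrow> 0 \<le> s \<Longrightarrow> 1 \<le> dilated_weight \<epsilon> s k"
  by (simp add: dilated_weight_def ge_one_powr_ge_zero infnorm_pos_le)

lemma dilated_weight_submult: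
  assumes "0 \<le> \<epsilon>" "0 \<le> s"
  shows "dilated_weight \<epsilon> s (k + l) \<le> dilated_weight \<epsilon> s k * dilated_weight \<epsilon> s l"
proof -
  have add: "lattice_point (k + l) = lattice_point k + lattice_point l"
    by (simp add: lattice_point_def vec_eq_iff)
  define a b where "a = \<epsilon> * infnorm (lattice_point k)" and "b = \<epsilon> * infnorm (lattice_point l)"
  have ab: "0 \<le> a" "0 \<le> b"
    using assms by (simp_all add: a_def b_def infnorm_pos_le)
  have "\<epsilon> * infnorm (lattice_point (k + l)) \<le> a + b"
    unfolding a_def b_def add distrib_left[symmetric]
    using assms by (intro mult_left_mono infnorm_triangle)
  then have "1 + \<epsilon> * infnorm (lattice_point (k + l)) \<le> (1 + a) * (1 + b)"
    using mult_nonneg_nonneg[OF ab] by (simp add: algebra_simps)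
  then have "(1 + \<epsilon> * infnorm (lattice_point (k + l))) powr s \<le> ((1 + a) * (1 + b)) powr s"
    using assms by (intro powr_mono2) (auto simp: infnorm_pos_le)
  then show ?thesis
    by (simp add: dilated_weight_def powr_mult a_def b_def)
qed

lemma dilated_weight_minus: "dilated_weight \<epsilon> s (- k) = dilated_weight \<epsilon> s k"
proof -
  have "lattice_point (- k) = - lattice_point k"
    by (simp add: lattice_point_def vec_eq_iff)
  then show ?thesis
    by (simp add: dilated_weight_def infnorm_neg)
qed

text \<open>
  Submultiplicativity makes the ratio of the values of the weight at two points at most
  \<open>\<rho> = dilated_weight \<epsilon> s (m - k)\<close>, in both directions. So the reciprocals differ by at most
  \<open>\<rho> - 1\<close> or \<open>1 - 1 / \<rho>\<close> times \<open>1 / dilated_weight \<epsilon> s k\<close>, and \<open>1 - 1 / \<rho> \<le> \<rho> - 1\<close>.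
  The bound is relative to the value at \<open>k\<close>: this lets the commutator with the multiplication by
  the reciprocal weight act on the weighted sequence again.
\<close>

lemma inverse_dilated_weight_variation:
  assumes "0 \<le> \<epsilon>" "0 \<le> s"
  shows "\<bar>1 / dilated_weight \<epsilon> s k - 1 / dilated_weight \<epsilon> s m\<bar>
    \<le> 1 / dilated_weight \<epsilon> s k * (dilated_weight \<epsilon> s (m - k) - 1)"
proof -
  define a b \<rho> where "a = dilated_weight \<epsilon> s k" and "b = dilated_weight \<epsilon> s m"
    and "\<rho> = dilated_weight \<epsilon> s (m - k)"
  have ge: "1 \<le> a" "1 \<le> b" "1 \<le> \<rho>"
    using assms by (simp_all add: a_def b_def \<rho>_def dilated_weight_ge_one)
  have "a \<le> b * \<rho>"
    using dilated_weight_submult[OF assms, of m "k - m"] dilated_weight_minus[of \<epsilon> s "m - k"]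
    by (simp add: a_def b_def \<rho>_def)
  then have "1 / b - 1 / a \<le> 1 / a * (\<rho> - 1)"
    using ge by (simp add: field_simps)
  moreover have "b \<le> a * \<rho>"
    using dilated_weight_submult[OF assms, of k "m - k"] by (simp add: a_def b_def \<rho>_def)
  then have "1 / (a * \<rho>) \<le> 1 / b"
    using ge by (intro divide_left_mono) auto
  moreover have "1 / a - 1 / (a * \<rho>) \<le> 1 / a * (\<rho> - 1)"
  proof -
    have "2 * \<rho> \<le> \<rho> * \<rho> + 1"
      using sum_squares_bound[of \<rho> 1] by (simp add: power2_eq_square)
    then have "1 - 1 / \<rho> \<le> \<rho> - 1"
      using ge by (simp add: field_simps)
    from mult_left_mono[OF this, of "1 / a"] show ?thesis
      using ge by (simp add: right_diff_distrib)
  qed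
  ultimately show ?thesis
    unfolding a_def[symmetric] b_def[symmetric] \<rho>_def[symmetric] by linarith
qed

lemma summable_inverse_dilated_weight:
  assumes "real CARD('d) < s" "0 < \<epsilon>" "\<epsilon> \<le> 1"
  shows "(\<integral>\<^sup>+(k::int^'d). ennreal (1 / dilated_weight \<epsilon> s k) \<partial>count_space UNIV) < \<infinity>"
proof -
  have s: "0 < s" using assms(1) by (simp add: order_le_less_trans[rotated])
  have "1 / dilated_weight \<epsilon> s k \<le> 1 / \<epsilon> powr s * (1 / poly_weight s k)" for k :: "int^'d"
  proof -
    define N where "N = infnorm (lattice_point k)"
    have N: "0 \<le> N" by (simp add: N_def infnorm_pos_le)
    have pos: "0 < (1 + \<epsilon> * N) powr s" "0 < (\<epsilon> * (1 + N)) powr s"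
      using assms N add_pos_nonneg[of 1 "\<epsilon> * N"] by auto
    have "(\<epsilon> * (1 + N)) powr s \<le> (1 + \<epsilon> * N) powr s"
      using assms s N by (intro powr_mono2) (auto simp: distrib_left)
    then have "1 / (1 + \<epsilon> * N) powr s \<le> 1 / (\<epsilon> * (1 + N)) powr s"
      using pos by (intro divide_left_mono mult_pos_pos) auto
    then show ?thesis
      using assms N by (simp add: dilated_weight_def poly_weight_def powr_mult N_def)
  qed
  then have "(\<integral>\<^sup>+(k::int^'d). ennreal (1 / dilated_weight \<epsilon> s k) \<partial>count_space UNIV)
      \<le> (\<integral>\<^sup>+(k::int^'d). ennreal (1 / \<epsilon> powr s) * ennreal (1 / poly_weight s k) \<partial>count_space UNIV)"
    by (intro nn_integral_mono) (simp add: ennreal_mult'[symmetric] ennreal_leI)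
  also have "\<dots> < \<infinity>"
    using summable_inverse_poly_weight[OF assms(1)]
    by (simp add: nn_integral_cmult ennreal_mult_less_top)
  finally show ?thesis .
qed

text \<open>
  Dominated convergence along \<open>\<epsilon> = 1 / (n + 1)\<close>: each term tends to \<open>0\<close> and is dominated by the
  corresponding term of the weighted sum of \<open>g\<close>.
\<close>

lemma small_dilated_moment:
  fixes g :: "int^'d \<Rightarrow> real"
  assumes s: "0 \<le> s" and g: "\<And>l. 0 \<le> g l"
    and fin: "(\<integral>\<^sup>+l. ennreal (poly_weight s l * g l) \<partial>count_space UNIV) < \<infinity>" and \<delta>: "0 < \<delta>"
  obtains \<epsilon> where "0 < \<epsilon>" "\<epsilon> \<le> 1"
    "(\<integral>\<^sup>+l. ennreal (g l * (dilated_weight \<epsilon> s l - 1)) \<partial>count_space UNIV) \<le> ennreal \<delta>"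
proof -
  define e where "e n = inverse (real (Suc n))" for n
  have e: "0 < e n" "e n \<le> 1" for n
    by (auto simp: e_def inverse_le_1_iff)
  define u where "u n l = ennreal (g l * (dilated_weight (e n) s l - 1))" for n and l :: "int^'d"
  have "(\<lambda>n. \<integral>\<^sup>+l. u n l \<partial>count_space UNIV) \<longlonglongrightarrow> (\<integral>\<^sup>+l. 0 \<partial>count_space (UNIV :: (int^'d) set))"
  proof (rule nn_integral_dominated_convergence[where w="\<lambda>l. ennreal (poly_weight s l * g l)"])
    show "AE l in count_space UNIV. u j l \<le> ennreal (poly_weight s l * g l)" for j
    proof (rule AE_I2, unfold u_def, rule ennreal_leI)
      fix l :: "int^'d"
      have "dilated_weight (e j) s l \<le> poly_weight s l"
        unfolding dilated_weight_def poly_weight_def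
        using e[of j] s by (intro powr_mono2) (auto simp: infnorm_pos_le mult_left_le_one_le)
      then have "dilated_weight (e j) s l - 1 \<le> poly_weight s l"
        by simp
      from mult_left_mono[OF this g[of l]]
      show "g l * (dilated_weight (e j) s l - 1) \<le> poly_weight s l * g l"
        by (simp add: mult.commute)
    qed
    show "AE l in count_space UNIV. (\<lambda>n. u n l) \<longlonglongrightarrow> 0"
    proof (rule AE_I2)
      fix l :: "int^'d"
      have "(\<lambda>n. g l * ((1 + e n * infnorm (lattice_point l)) powr s - 1))
          \<longlonglongrightarrow> g l * ((1 + 0 * infnorm (lattice_point l)) powr s - 1)"
        unfolding e_def by (intro tendsto_intros LIMSEQ_inverse_real_of_nat) auto
      then have "(\<lambda>n. ennreal (g l * ((1 + e n * infnorm (lattice_point l)) powr s - 1))) \<longlonglongrightarrow> ennreal 0"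
        by (intro tendsto_ennrealI) simp
      then show "(\<lambda>n. u n l) \<longlonglongrightarrow> 0"
        by (simp add: u_def dilated_weight_def)
    qed
  qed (use fin in auto)
  then have "(\<lambda>n. \<integral>\<^sup>+l. u n l \<partial>count_space UNIV) \<longlonglongrightarrow> 0" by simp
  then have "\<forall>\<^sub>F n in sequentially. (\<integral>\<^sup>+l. u n l \<partial>count_space UNIV) < ennreal \<delta>"
    using \<delta> by (intro order_tendstoD) auto
  then obtain n where "(\<integral>\<^sup>+l. u n l \<partial>count_space UNIV) < ennreal \<delta>"
    by (auto simp: eventually_sequentially)
  then show ?thesis
    using e[of n] by (intro that[of "e n"]) (auto simp: u_def)
qed

section \<open>Lower bounds of localized matrices\<close>

text \<open>
  The row \<open>j\<close> is concentrated around the lattice point \<open>y j\<close>, with an envelope \<open>g\<close> of weighted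
  summable decay, and at most \<open>D\<close> rows share a centre. Locality is measured through \<open>y\<close> because the
  given enumeration of the sampling points says nothing about their positions.
\<close>

locale localized_matrix =
  fixes A :: "'j \<Rightarrow> int^'d \<Rightarrow> complex" and y :: "'j \<Rightarrow> int^'d" and g :: "int^'d \<Rightarrow> real"
    and s D :: real
  assumes decay: "real CARD('d) < s"
    and envelope_nonneg: "0 \<le> g l"
    and envelope_sum: "(\<integral>\<^sup>+l. ennreal (poly_weight s l * g l) \<partial>count_space UNIV) < \<infinity>"
    and entry_le: "norm (A j k) \<le> g (y j - k)"
    and multiplicity_pos: "0 < D"
    and multiplicity: "emeasure (count_space UNIV) {j. y j = n} \<le> ennreal D"
begin

definition apply_matrix :: "(int^'d \<Rightarrow> complex) \<Rightarrow> 'j \<Rightarrow> complex" where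
  "apply_matrix c j = (\<Sum>\<^sub>\<infinity>k. c k * A j k)"

lemma exponent_pos: "0 < s"
  using decay by (simp add: order_le_less_trans[rotated])

text \<open>
  Grouping the rows by their centre, each lattice point occurs at most \<open>D\<close> times.
\<close>

lemma sum_over_rows_le:
  "(\<integral>\<^sup>+j. F (y j) \<partial>count_space UNIV) \<le> ennreal D * (\<integral>\<^sup>+n. F n \<partial>count_space UNIV)"
proof -
  have "(\<integral>\<^sup>+j. F (y j) \<partial>count_space UNIV)
      = (\<integral>\<^sup>+j. \<integral>\<^sup>+n. F n * indicator {y j} n \<partial>count_space UNIV \<partial>count_space UNIV)"
    by (intro nn_integral_cong) (simp add: nn_integral_indicator_singleton)
  also have "\<dots> = (\<integral>\<^sup>+n. \<integral>\<^sup>+j. F n * indicator {j. y j = n} j \<partial>count_space UNIV \<partial>count_space UNIV)"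
    by (subst nn_integral_count_space_swap)
      (auto intro!: nn_integral_cong simp: indicator_def)
  also have "\<dots> = (\<integral>\<^sup>+n. F n * emeasure (count_space UNIV) {j. y j = n} \<partial>count_space UNIV)"
    by (simp add: nn_integral_cmult_indicator)
  also have "\<dots> \<le> (\<integral>\<^sup>+n. F n * ennreal D \<partial>count_space UNIV)"
    by (intro nn_integral_mono mult_left_mono multiplicity) simp
  finally show ?thesis
    by (simp add: nn_integral_multc mult.commute[of _ "ennreal D"] nn_integral_cmult)
qed

lemma kernel_sums:
  fixes h :: "int^'d \<Rightarrow> ennreal"
  shows kernel_row_sum: "(\<integral>\<^sup>+k. h (m - k) \<partial>count_space UNIV) = (\<integral>\<^sup>+l. h l \<partial>count_space UNIV)"
    and kernel_column_sum:
      "(\<integral>\<^sup>+j. h (y j - k) \<partial>count_space UNIV) \<le> ennreal D * (\<integral>\<^sup>+l. h l \<partial>count_space UNIV)"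
proof -
  have bij: "bij_betw (\<lambda>k. m - k) UNIV UNIV" for m :: "int^'d"
    by (rule bij_betwI[of _ _ _ "\<lambda>k. m - k"]) auto
  show "(\<integral>\<^sup>+k. h (m - k) \<partial>count_space UNIV) = (\<integral>\<^sup>+l. h l \<partial>count_space UNIV)"
    by (rule nn_integral_bij_count_space[OF bij])
  have bij': "bij_betw (\<lambda>n. n - k) UNIV UNIV"
    by (rule bij_betwI[of _ _ _ "\<lambda>n. n + k"]) auto
  show "(\<integral>\<^sup>+j. h (y j - k) \<partial>count_space UNIV) \<le> ennreal D * (\<integral>\<^sup>+l. h l \<partial>count_space UNIV)"
    using sum_over_rows_le[of "\<lambda>n. h (n - k)"] nn_integral_bij_count_space[OF bij', of h]
    by simp
qed

text \<open>
  The factor \<open>1 + D\<close> serves the row sums (at most \<open>H\<close>) and the column sums (at most \<open>D * H\<close>) at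
  once, so that the Schur test applies to the kernel and to its transpose with the same constant.
\<close>

lemma kernel_sums_le:
  fixes h :: "int^'d \<Rightarrow> ennreal"
  assumes h: "(\<integral>\<^sup>+l. h l \<partial>count_space UNIV) \<le> ennreal H" and H: "0 < H"
  shows "(\<integral>\<^sup>+k. h (m - k) \<partial>count_space UNIV) \<le> ennreal ((1 + D) * H)"
    and "(\<integral>\<^sup>+j. h (y j - k) \<partial>count_space UNIV) \<le> ennreal ((1 + D) * H)"
proof -
  have "ennreal H \<le> ennreal ((1 + D) * H)" "ennreal (D * H) \<le> ennreal ((1 + D) * H)"
    using H multiplicity_pos by (auto intro!: ennreal_leI simp: distrib_right)
  moreover have "ennreal D * (\<integral>\<^sup>+l. h l \<partial>count_space UNIV) \<le> ennreal (D * H)"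
    using h multiplicity_pos by (simp add: ennreal_mult' mult_left_mono)
  ultimately show "(\<integral>\<^sup>+k. h (m - k) \<partial>count_space UNIV) \<le> ennreal ((1 + D) * H)"
    and "(\<integral>\<^sup>+j. h (y j - k) \<partial>count_space UNIV) \<le> ennreal ((1 + D) * H)"
    using kernel_row_sum[of h m] kernel_column_sum[of h k] h by (auto intro: order_trans)
qed

lemma kernel_bounded:
  fixes h :: "int^'d \<Rightarrow> ennreal"
  assumes "admissible_exponent p" "0 < H" "(\<integral>\<^sup>+l. h l \<partial>count_space UNIV) \<le> ennreal H"
    and "\<And>j. ennreal (norm (f j)) \<le> (\<integral>\<^sup>+k. h (y j - k) * ennreal (norm (c k)) \<partial>count_space UNIV)"
  shows "seq_norm p f \<le> ennreal (2 * ((1 + D) * H)) * seq_norm p c"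
  using assms multiplicity_pos
  by (intro schur_test[where b="\<lambda>j k. h (y j - k)"] kernel_sums_le) auto

lemma transposed_kernel_bounded:
  fixes h :: "int^'d \<Rightarrow> ennreal"
  assumes "admissible_exponent p" "0 < H" "(\<integral>\<^sup>+l. h l \<partial>count_space UNIV) \<le> ennreal H"
    and "\<And>k. ennreal (norm (c k)) \<le> (\<integral>\<^sup>+j. h (y j - k) * ennreal (norm (f j)) \<partial>count_space UNIV)"
  shows "seq_norm p c \<le> ennreal (2 * ((1 + D) * H)) * seq_norm p f"
  using assms multiplicity_pos
  by (intro schur_test[where b="\<lambda>k j. h (y j - k)"] kernel_sums_le) auto

lemma envelope_bound:
  obtains G where "0 < G" "(\<integral>\<^sup>+l. ennreal (g l) \<partial>count_space UNIV) \<le> ennreal G"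
proof -
  have "(\<integral>\<^sup>+l. ennreal (g l) \<partial>count_space UNIV)
      \<le> (\<integral>\<^sup>+l. ennreal (poly_weight s l * g l) \<partial>count_space UNIV)"
  proof (intro nn_integral_mono ennreal_leI)
    fix l :: "int^'d"
    have "1 \<le> poly_weight s l"
      using exponent_pos by (simp add: poly_weight_def ge_one_powr_ge_zero infnorm_pos_le)
    from mult_right_mono[OF this envelope_nonneg[of l]] show "g l \<le> poly_weight s l * g l"
      by simp
  qed
  then have "(\<integral>\<^sup>+l. ennreal (g l) \<partial>count_space UNIV) < \<infinity>"
    using envelope_sum by simp
  then obtain G where G: "(\<integral>\<^sup>+l. ennreal (g l) \<partial>count_space UNIV) = ennreal G" "0 \<le> G"
    by (cases "\<integral>\<^sup>+l. ennreal (g l) \<partial>count_space UNIV") auto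
  then show ?thesis
    by (intro that[of "1 + G"]) (auto intro: ennreal_leI)
qed

lemma row_entries_le:
  "(\<integral>\<^sup>+k. ennreal (norm (c k * A j k)) \<partial>count_space UNIV)
    \<le> (\<integral>\<^sup>+k. ennreal (g (y j - k)) * ennreal (norm (c k)) \<partial>count_space UNIV)"
  using entry_le[of j] envelope_nonneg
  by (intro nn_integral_mono)
    (auto simp: norm_mult mult.commute ennreal_mult'[symmetric] intro!: ennreal_leI mult_left_mono)

lemma bounded_row_finite:
  assumes c: "\<And>k. norm (c k) \<le> B"
  shows "(\<integral>\<^sup>+k. ennreal (g (y j - k)) * ennreal (norm (c k)) \<partial>count_space UNIV) < \<infinity>"
proof -
  obtain G where G: "0 < G" "(\<integral>\<^sup>+l. ennreal (g l) \<partial>count_space UNIV) \<le> ennreal G"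
    by (rule envelope_bound)
  have "(\<integral>\<^sup>+k. ennreal (g (y j - k)) * ennreal (norm (c k)) \<partial>count_space UNIV)
      \<le> (\<integral>\<^sup>+k. ennreal (g (y j - k)) * ennreal B \<partial>count_space UNIV)"
    using c by (intro nn_integral_mono mult_left_mono ennreal_leI) auto
  also have "\<dots> \<le> ennreal G * ennreal B"
    using G kernel_row_sum[of "\<lambda>l. ennreal (g l)" "y j"]
    by (auto simp: nn_integral_multc intro: mult_right_mono)
  also have "\<dots> < \<infinity>" by (simp add: ennreal_mult_less_top)
  finally show ?thesis .
qed

lemma bounded_row_summable:
  assumes c: "\<And>k. norm (c k) \<le> B"
  shows "(\<lambda>k. c k * A j k) summable_on UNIV"
    and "ennreal (norm (apply_matrix c j))
      \<le> (\<integral>\<^sup>+k. ennreal (g (y j - k)) * ennreal (norm (c k)) \<partial>count_space UNIV)"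
proof -
  have fin: "(\<integral>\<^sup>+k. ennreal (norm (c k * A j k)) \<partial>count_space UNIV) < \<infinity>"
    using bounded_row_finite[of c B j] row_entries_le[of c j] c by simp
  show "(\<lambda>k. c k * A j k) summable_on UNIV"
    by (rule infsum_nn_bound(1)[OF fin])
  show "ennreal (norm (apply_matrix c j))
      \<le> (\<integral>\<^sup>+k. ennreal (g (y j - k)) * ennreal (norm (c k)) \<partial>count_space UNIV)"
    unfolding apply_matrix_def
    by (rule order_trans[OF infsum_nn_bound(2)[OF fin] row_entries_le])
qed

lemma matrix_bounded:
  obtains K where "0 < K"
    "\<And>q c B. admissible_exponent q \<Longrightarrow> (\<And>k. norm (c k) \<le> B) \<Longrightarrow>
      seq_norm q (apply_matrix c) \<le> ennreal K * seq_norm q c"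
proof -
  obtain G where G: "0 < G" "(\<integral>\<^sup>+l. ennreal (g l) \<partial>count_space UNIV) \<le> ennreal G"
    by (rule envelope_bound)
  show ?thesis
  proof
    show "0 < 2 * ((1 + D) * G)"
      using G multiplicity_pos by simp
    show "seq_norm q (apply_matrix c) \<le> ennreal (2 * ((1 + D) * G)) * seq_norm q c"
      if "admissible_exponent q" "\<And>k. norm (c k) \<le> B" for q c B
      using that G by (intro kernel_bounded[where h="\<lambda>l. ennreal (g l)"] bounded_row_summable(2))
  qed
qed

text \<open>
  Finitely supported sequences are mapped to summable sequences, hence to null sequences. A null
  sequence is a finitely supported one up to a small error in the supremum norm, and the matrix is
  bounded in that norm.
\<close>

lemma apply_matrix_null:
  assumes c: "(c \<longlongrightarrow> 0) cofinite"
  shows "(apply_matrix c \<longlongrightarrow> 0) cofinite"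
proof (rule tendstoI)
  fix e :: real assume e: "0 < e"
  obtain K where K: "0 < K" "\<And>q c B. admissible_exponent q \<Longrightarrow> (\<And>k. norm (c k) \<le> B) \<Longrightarrow>
      seq_norm q (apply_matrix c) \<le> ennreal K * seq_norm q c"
    by (rule matrix_bounded) blast
  define \<eta> where "\<eta> = e / (2 * K)"
  have \<eta>: "0 < \<eta>" using e K by (simp add: \<eta>_def)
  define F where "F = {k. \<not> norm (c k) < \<eta>}"
  have F: "finite F"
    using tendstoD[OF c \<eta>] by (simp add: F_def eventually_cofinite)
  \<comment> \<open>The large entries form a finitely supported sequence, the others have supremum at most \<open>\<eta>\<close>.\<close>
  define c1 c2 where "c1 k = (if k \<in> F then c k else 0)" and "c2 k = (if k \<in> F then 0 else c k)" for k
  have c1: "norm (c1 k) \<le> (\<Sum>k\<in>F. norm (c k))" for k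
    using F member_le_sum[of k F "\<lambda>k. norm (c k)"] by (auto simp: c1_def sum_nonneg)
  have c2: "norm (c2 k) \<le> \<eta>" for k
    using \<eta> by (auto simp: c2_def F_def)
  have split: "apply_matrix c j = apply_matrix c1 j + apply_matrix c2 j" for j
  proof -
    have "(\<lambda>k. c k * A j k) = (\<lambda>k. c1 k * A j k + c2 k * A j k)"
      by (auto simp: c1_def c2_def)
    then show ?thesis
      unfolding apply_matrix_def
      using infsum_add[OF bounded_row_summable(1)[of c1, OF c1] bounded_row_summable(1)[of c2, OF c2], of j j]
      by simp
  qed
  have one: "admissible_exponent 1" by (simp add: admissible_exponent_def)
  have norm1: "seq_norm 1 f = (\<integral>\<^sup>+k. ennreal (norm (f k)) \<partial>count_space UNIV)" for f :: "'i \<Rightarrow> complex"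
    by (cases "\<integral>\<^sup>+k. ennreal (norm (f k)) \<partial>count_space UNIV") (auto simp: seq_norm_def Lp_norm_def)
  have "seq_norm 1 c1 = (\<Sum>k\<in>F. ennreal (norm (c1 k)))"
    unfolding norm1 using F by (intro nn_integral_count_space') (auto simp: c1_def)
  then have "seq_norm 1 c1 < \<infinity>" by simp
  then have "ennreal K * seq_norm 1 c1 < \<infinity>"
    by (simp add: ennreal_mult_less_top)
  then have "(apply_matrix c1 \<longlongrightarrow> 0) cofinite"
    using K(2)[of 1 c1 "\<Sum>k\<in>F. norm (c k)", OF one c1] by (intro summable_imp_null) (simp add: norm1)
  then have "\<forall>\<^sub>F j in cofinite. dist (apply_matrix c1 j) 0 < e / 2"
    using e by (intro tendstoD) auto
  then show "\<forall>\<^sub>F j in cofinite. dist (apply_matrix c j) 0 < e"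
  proof eventually_elim
    case (elim j)
    have inf: "admissible_exponent \<infinity>" by (simp add: admissible_exponent_def)
    have "seq_norm \<infinity> c2 \<le> ennreal \<eta>"
      using c2 by (simp add: seq_norm_le_iff_sup ennreal_leI)
    have "ennreal (norm (apply_matrix c2 j)) \<le> ennreal K * seq_norm \<infinity> c2"
      by (rule order_trans[OF norm_le_seq_norm[OF inf] K(2)[OF inf c2]])
    also have "\<dots> \<le> ennreal K * ennreal \<eta>"
      by (rule mult_left_mono) (fact, simp)
    also have "\<dots> = ennreal (e / 2)"
      using K \<eta> by (simp add: ennreal_mult'[symmetric] \<eta>_def)
    finally have "norm (apply_matrix c2 j) \<le> e / 2"
      using e by (simp add: ennreal_le_iff)
    then show ?case
      using elim norm_triangle_ineq[of "apply_matrix c1 j" "apply_matrix c2 j"] by (simp add: split)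
  qed
qed

text \<open>
  The commutator of the matrix with the multiplication by \<open>w\<close> has the entries
  \<open>(w k - w (y j)) * A j k\<close>. Because the variation of \<open>w\<close> is controlled relative to \<open>w k\<close>, it
  is dominated by the kernel \<open>g * \<rho>\<close> applied to the weighted sequence \<open>w * c\<close>, not merely to \<open>c\<close>.
\<close>

lemma commutator_bound:
  fixes w :: "int^'d \<Rightarrow> real" and c :: "int^'d \<Rightarrow> complex"
  assumes c: "\<And>k. norm (c k) \<le> B" and w: "\<And>k. 0 \<le> w k" "\<And>k. w k \<le> 1"
    and var: "\<And>k m. \<bar>w k - w m\<bar> \<le> w k * \<rho> (m - k)" and \<rho>: "\<And>l. 0 \<le> \<rho> l"
  shows "ennreal (norm (apply_matrix (\<lambda>k. w k * c k) j - w (y j) * apply_matrix c j))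
    \<le> (\<integral>\<^sup>+k. ennreal (g (y j - k) * \<rho> (y j - k)) * ennreal (norm (w k * c k)) \<partial>count_space UNIV)"
proof -
  have dc: "norm ((w k - w (y j)) * c k) \<le> B" for k
  proof -
    have "norm ((of_real (w k) - of_real (w (y j))) * c k) \<le> 1 * norm (c k)"
      unfolding norm_mult of_real_diff[symmetric] norm_of_real
      using w[of k] w[of "y j"] by (intro mult_right_mono) auto
    then show ?thesis using c[of k] by simp
  qed
  have eq: "apply_matrix (\<lambda>k. w k * c k) j - w (y j) * apply_matrix c j
      = apply_matrix (\<lambda>k. (w k - w (y j)) * c k) j"
  proof -
    have "apply_matrix (\<lambda>k. w k * c k) j
        = (\<Sum>\<^sub>\<infinity>k. (w k - w (y j)) * c k * A j k + w (y j) * (c k * A j k))"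
      unfolding apply_matrix_def by (simp add: algebra_simps)
    also have "\<dots> = apply_matrix (\<lambda>k. (w k - w (y j)) * c k) j + (\<Sum>\<^sub>\<infinity>k. w (y j) * (c k * A j k))"
      unfolding apply_matrix_def
      by (intro infsum_add summable_on_cmult_right bounded_row_summable(1)[OF dc] bounded_row_summable(1)[OF c])
    also have "(\<Sum>\<^sub>\<infinity>k. w (y j) * (c k * A j k)) = w (y j) * apply_matrix c j"
      unfolding apply_matrix_def by (intro infsum_cmult_right bounded_row_summable(1)[OF c])
    finally show ?thesis by simp
  qed
  have "ennreal (norm (apply_matrix (\<lambda>k. (w k - w (y j)) * c k) j))
      \<le> (\<integral>\<^sup>+k. ennreal (g (y j - k)) * ennreal (norm ((w k - w (y j)) * c k)) \<partial>count_space UNIV)"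
    by (rule bounded_row_summable(2)[OF dc])
  also have "\<dots> \<le> (\<integral>\<^sup>+k. ennreal (g (y j - k) * \<rho> (y j - k)) * ennreal (norm (w k * c k))
      \<partial>count_space UNIV)"
  proof (rule nn_integral_mono)
    fix k
    have "norm ((of_real (w k) - of_real (w (y j))) * c k) \<le> (w k * \<rho> (y j - k)) * norm (c k)"
      unfolding norm_mult of_real_diff[symmetric] norm_of_real
      by (intro mult_right_mono var) auto
    then have "g (y j - k) * norm ((of_real (w k) - of_real (w (y j))) * c k)
        \<le> g (y j - k) * ((w k * \<rho> (y j - k)) * norm (c k))"
      by (intro mult_left_mono envelope_nonneg)
    also have "\<dots> = g (y j - k) * \<rho> (y j - k) * norm (of_real (w k) * c k)"
      using w by (simp add: norm_mult)
    finally show "ennreal (g (y j - k)) * ennreal (norm ((w k - w (y j)) * c k))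
        \<le> ennreal (g (y j - k) * \<rho> (y j - k)) * ennreal (norm (w k * c k))"
      using envelope_nonneg \<rho> by (simp add: ennreal_mult'[symmetric] ennreal_leI)
  qed
  finally show ?thesis
    unfolding eq .
qed

text \<open>
  This is the heart of the argument. Let \<open>v\<close> be the product of \<open>c\<close> with the reciprocal dilated weight
  centred at \<open>n\<close>; it is summable, so the assumed lower bound for the exponent \<open>p\<close> applies to it.
  Replacing the image of \<open>v\<close> by the weighted image of \<open>c\<close> costs a commutator, whose norm is a small
  multiple of the norm of \<open>v\<close> once \<open>\<epsilon>\<close> is small. This error is absorbed into the left-hand side.
  The smallness does not depend on \<open>n\<close>, since the weights centred at different points are
  translates of each other. Finally, bounding the norm of \<open>v\<close> below by its value at \<open>n\<close>, and the
  norm of the weighted image above by its sum, removes the exponent from the estimate.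
\<close>

lemma localized_lower_bound:
  assumes p: "admissible_exponent p" and C: "0 < C"
    and below: "\<And>c. c \<in> seq_space p \<Longrightarrow> seq_norm p c \<le> ennreal C * seq_norm p (apply_matrix c)"
  obtains w :: "int^'d \<Rightarrow> real" where
    "\<And>l. 0 \<le> w l" "(\<integral>\<^sup>+l. ennreal (w l) \<partial>count_space UNIV) < \<infinity>"
    "\<And>c B n. (\<And>k. norm (c k) \<le> B) \<Longrightarrow> ennreal (norm (c n))
      \<le> (\<integral>\<^sup>+j. ennreal (w (y j - n)) * ennreal (norm (apply_matrix c j)) \<partial>count_space UNIV)"
proof -
  \<comment> \<open>Chosen such that the commutator, of norm at most \<open>2 * ((1 + D) * \<delta>)\<close>, contributes half of the norm of \<open>v\<close> after the factor \<open>2 * C\<close>.\<close>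
  define \<delta> where "\<delta> = 1 / (8 * C * (1 + D))"
  have \<delta>: "0 < \<delta>" using C multiplicity_pos by (simp add: \<delta>_def)
  obtain \<epsilon> where \<epsilon>: "0 < \<epsilon>" "\<epsilon> \<le> 1" and
    small: "(\<integral>\<^sup>+l. ennreal (g l * (dilated_weight \<epsilon> s l - 1)) \<partial>count_space UNIV) \<le> ennreal \<delta>"
    using small_dilated_moment[of s g \<delta>] exponent_pos envelope_nonneg envelope_sum \<delta> by auto
  define w where "w l = 1 / dilated_weight \<epsilon> s l" for l :: "int^'d"
  have ge_one: "1 \<le> dilated_weight \<epsilon> s l" for l :: "int^'d"
    using \<epsilon> exponent_pos by (simp add: dilated_weight_ge_one)
  have w: "0 \<le> w l" "w l \<le> 1" for l
    using ge_one[of l] by (auto simp: w_def)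
  have w0: "w 0 = 1"
    by (simp add: w_def dilated_weight_def lattice_point_def zero_vec_def[symmetric] infnorm_0)
  have w_sum: "(\<integral>\<^sup>+l. ennreal (w l) \<partial>count_space UNIV) < \<infinity>"
    unfolding w_def using decay \<epsilon> by (rule summable_inverse_dilated_weight)
  have main: "ennreal (norm (c n)) \<le> (\<integral>\<^sup>+j. ennreal (4 * C * w (y j - n)) * ennreal (norm (apply_matrix c j))
      \<partial>count_space UNIV)" if c: "\<And>k. norm (c k) \<le> B" for c B n
  proof -
    define v where "v k = of_real (w (k - n)) * c k" for k
    define Ac where "Ac j = of_real (w (y j - n)) * apply_matrix c j" for j
    define R where "R j = apply_matrix v j - Ac j" for j
    have v_sum: "(\<integral>\<^sup>+k. ennreal (norm (v k)) \<partial>count_space UNIV) < \<infinity>"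
    proof -
      have bij: "bij_betw (\<lambda>k. k - n) UNIV UNIV"
        by (rule bij_betwI[of _ _ _ "\<lambda>k. k + n"]) auto
      have "(\<integral>\<^sup>+k. ennreal (norm (v k)) \<partial>count_space UNIV)
          \<le> (\<integral>\<^sup>+k. ennreal (w (k - n)) * ennreal B \<partial>count_space UNIV)"
        using c w by (intro nn_integral_mono)
          (auto simp: v_def norm_mult ennreal_mult'[symmetric] intro!: ennreal_leI mult_left_mono)
      also have "\<dots> = (\<integral>\<^sup>+l. ennreal (w l) \<partial>count_space UNIV) * ennreal B"
        using nn_integral_bij_count_space[OF bij, of "\<lambda>l. ennreal (w l)"] by (simp add: nn_integral_multc)
      also have "\<dots> < \<infinity>"
        using w_sum by (simp add: ennreal_mult_less_top)
      finally show ?thesis .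
    qed
    have v: "v \<in> seq_space p"
      by (rule summable_in_seq_space[OF p v_sum])
    have "seq_norm p R \<le> ennreal (2 * ((1 + D) * \<delta>)) * seq_norm p v"
    proof (rule kernel_bounded[OF p \<delta> small])
      fix j
      have "ennreal (norm (apply_matrix (\<lambda>k. of_real (w (k - n)) * c k) j
            - of_real (w (y j - n)) * apply_matrix c j))
          \<le> (\<integral>\<^sup>+k. ennreal (g (y j - k) * (dilated_weight \<epsilon> s (y j - k) - 1))
              * ennreal (norm (of_real (w (k - n)) * c k)) \<partial>count_space UNIV)"
      proof (rule commutator_bound[where w="\<lambda>k. w (k - n)" and \<rho>="\<lambda>l. dilated_weight \<epsilon> s l - 1", OF c])
        show "\<bar>w (k - n) - w (m - n)\<bar> \<le> w (k - n) * (dilated_weight \<epsilon> s (m - k) - 1)" for k m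
          using inverse_dilated_weight_variation[of \<epsilon> s "k - n" "m - n"] \<epsilon> exponent_pos
          by (simp add: w_def)
      qed (use w ge_one in auto)
      then show "ennreal (norm (R j)) \<le> (\<integral>\<^sup>+k. ennreal (g (y j - k) * (dilated_weight \<epsilon> s (y j - k) - 1))
              * ennreal (norm (v k)) \<partial>count_space UNIV)"
        by (simp add: R_def Ac_def v_def[abs_def])
    qed
    also have "2 * ((1 + D) * \<delta>) = 1 / (4 * C)"
    proof -
      have "2 * (E * (1 / (8 * C * E))) = 1 / (4 * C)" if "0 < E" for E
        using that C by (simp add: field_simps)
      then show ?thesis
        unfolding \<delta>_def using multiplicity_pos by simp
    qed
    finally have R: "seq_norm p R \<le> ennreal (1 / (4 * C)) * seq_norm p v" .
    have "seq_norm p (apply_matrix v) \<le> 2 * (seq_norm p Ac + seq_norm p R)"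
      using p norm_triangle_sub[of "apply_matrix v _" "Ac _"]
      by (intro seq_norm_quasi_triangle) (auto simp: R_def)
    with below[OF v] have "seq_norm p v \<le> ennreal C * (2 * (seq_norm p Ac + seq_norm p R))"
      by (meson mult_left_mono order_trans zero_le)
    also have "\<dots> \<le> ennreal C * (2 * (seq_norm p Ac + ennreal (1 / (4 * C)) * seq_norm p v))"
      by (intro mult_left_mono add_left_mono R) auto
    finally have absorb: "seq_norm p v \<le> ennreal C * (2 * (seq_norm p Ac + ennreal (1 / (4 * C)) * seq_norm p v))" .
    \<comment> \<open>Half of the norm of \<open>v\<close>, which is finite because \<open>v\<close> is summable, moves to the left-hand side.\<close>
    have "seq_norm p v \<le> ennreal (4 * C) * seq_norm p Ac"
    proof (cases "seq_norm p Ac")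
      case (real a)
      obtain b where b: "seq_norm p v = ennreal b" "0 \<le> b"
        using v_sum seq_norm_le_sum[OF p, of v] by (cases "seq_norm p v") auto
      define z where "z = 1 / (4 * C) * b"
      have z: "0 \<le> z" using b C by (simp add: z_def)
      have "ennreal (1 / (4 * C)) * ennreal b = ennreal z"
        using C b by (simp add: z_def ennreal_mult'[symmetric])
      moreover have "ennreal a + ennreal z = ennreal (a + z)"
        using real z by simp
      moreover have "2 * ennreal (a + z) = ennreal (2 * (a + z))"
        using real z by (intro numeral_mult_ennreal) simp
      moreover have "ennreal C * ennreal (2 * (a + z)) = ennreal (C * (2 * (a + z)))"
        using real z C by (intro ennreal_mult'[symmetric]) simp
      ultimately have "ennreal C * (2 * (ennreal a + ennreal (1 / (4 * C)) * ennreal b))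
          = ennreal (C * (2 * (a + 1 / (4 * C) * b)))"
        unfolding z_def by (simp only:)
      then have "ennreal b \<le> ennreal (C * (2 * (a + 1 / (4 * C) * b)))"
        using absorb unfolding real b by simp
      then have "b \<le> C * (2 * (a + 1 / (4 * C) * b))"
        using C real b by (subst (asm) ennreal_le_iff) auto
      then have "b \<le> 4 * C * a"
        using C by (simp add: field_simps)
      then show ?thesis
        using C real b by (simp add: ennreal_mult'[symmetric] ennreal_leI)
    qed (use C in \<open>simp add: ennreal_mult_top\<close>)
    have "ennreal (norm (c n)) = ennreal (norm (v n))"
      by (simp add: v_def w0)
    also have "\<dots> \<le> seq_norm p v"
      by (rule norm_le_seq_norm[OF p])
    also have "\<dots> \<le> ennreal (4 * C) * seq_norm p Ac" by fact
    also have "\<dots> \<le> ennreal (4 * C) * (\<integral>\<^sup>+j. ennreal (norm (Ac j)) \<partial>count_space UNIV)"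
      by (intro mult_left_mono seq_norm_le_sum[OF p]) simp
    also have "\<dots> = (\<integral>\<^sup>+j. ennreal (4 * C) * ennreal (norm (Ac j)) \<partial>count_space UNIV)"
      by (simp add: nn_integral_cmult)
    also have "\<dots> = (\<integral>\<^sup>+j. ennreal (4 * C * w (y j - n)) * ennreal (norm (apply_matrix c j))
        \<partial>count_space UNIV)"
      using C w by (intro nn_integral_cong)
        (simp add: Ac_def norm_mult ennreal_mult'[symmetric] mult.assoc)
    finally show ?thesis .
  qed
  show ?thesis
  proof (rule that[of "\<lambda>l. 4 * C * w l"])
    show "(\<integral>\<^sup>+l. ennreal (4 * C * w l) \<partial>count_space UNIV) < \<infinity>"
      using w_sum C by (simp add: ennreal_mult' nn_integral_cmult ennreal_mult_less_top)
    show "0 \<le> 4 * C * w l" for l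
      using C w by simp
    show "ennreal (norm (c n))
        \<le> (\<integral>\<^sup>+j. ennreal (4 * C * w (y j - n)) * ennreal (norm (apply_matrix c j)) \<partial>count_space UNIV)"
      if "\<And>k. norm (c k) \<le> B" for c B n
      using that by (rule main)
  qed
qed

text \<open>
  The pointwise estimate of \<open>localized_lower_bound\<close> bounds \<open>c\<close> by a summable kernel applied to the
  image of \<open>c\<close>, and the Schur test turns it into a norm inequality for every exponent.
\<close>

lemma lower_bound_transfer:
  assumes p: "admissible_exponent p" and C: "0 < C"
    and below: "\<And>c. c \<in> seq_space p \<Longrightarrow> seq_norm p c \<le> ennreal C * seq_norm p (apply_matrix c)"
  obtains K where "0 < K"
    "\<And>q c. admissible_exponent q \<Longrightarrow> c \<in> seq_space q \<Longrightarrow>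
      seq_norm q c \<le> ennreal K * seq_norm q (apply_matrix c)"
proof -
  obtain w :: "int^'d \<Rightarrow> real" where w: "\<And>l. 0 \<le> w l" "(\<integral>\<^sup>+l. ennreal (w l) \<partial>count_space UNIV) < \<infinity>"
    and le: "\<And>c B n. (\<And>k. norm (c k) \<le> B) \<Longrightarrow> ennreal (norm (c n))
      \<le> (\<integral>\<^sup>+j. ennreal (w (y j - n)) * ennreal (norm (apply_matrix c j)) \<partial>count_space UNIV)"
    using localized_lower_bound[OF p C below] by blast
  obtain W where W: "(\<integral>\<^sup>+l. ennreal (w l) \<partial>count_space UNIV) = ennreal W" "0 \<le> W"
    using w(2) by (cases "\<integral>\<^sup>+l. ennreal (w l) \<partial>count_space UNIV") auto
  show ?thesis
  proof
    show "0 < 2 * ((1 + D) * (1 + W))"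
      using W multiplicity_pos by simp
    show "seq_norm q c \<le> ennreal (2 * ((1 + D) * (1 + W))) * seq_norm q (apply_matrix c)"
      if q: "admissible_exponent q" and c: "c \<in> seq_space q" for q c
    proof -
      obtain B where B: "\<And>k. norm (c k) \<le> B"
        using seq_space_bounded[OF q c] by blast
      show ?thesis
        using W le[of c B] B q
        by (intro transposed_kernel_bounded[where h="\<lambda>l. ennreal (w l)"]) (auto intro: ennreal_leI)
    qed
  qed
qed

end

section \<open>Sampling in shift-invariant spaces\<close>

text \<open>
  For a continuous function the essential supremum over the unit cube bounds all values: a larger
  value would persist on a nonempty open subset of the open cube, which is not negligible.
\<close>

lemma wiener_envelope:
  fixes \<phi> :: "real^'d \<Rightarrow> complex"
  assumes \<phi>: "\<phi> \<in> wiener_amalgam (poly_weight s)" and cont: "continuous_on UNIV \<phi>"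
  obtains g :: "int^'d \<Rightarrow> real" where "\<And>l. 0 \<le> g l"
    "(\<integral>\<^sup>+l. ennreal (poly_weight s l * g l) \<partial>count_space UNIV) < \<infinity>"
    "\<And>l z. z \<in> cbox 0 1 \<Longrightarrow> norm (\<phi> (z + lattice_point l)) \<le> g l"
proof -
  define E where "E l = esssup (lebesgue_on (cbox 0 1)) (\<lambda>z. ennreal (norm (\<phi> (z + lattice_point l))))"
    for l :: "int^'d"
  define S where "S = (\<Sum>\<^sub>\<infinity>l. ennreal (poly_weight s l) * E l)"
  have S: "S < \<infinity>"
    using \<phi> by (simp add: wiener_amalgam_def S_def E_def)
  have sum_le: "(\<Sum>l\<in>F. ennreal (poly_weight s l) * E l) \<le> S" if "finite F" for F
    unfolding S_def using that by (subst nonneg_infsum_complete) (auto intro: SUP_upper)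
  have weight_pos: "0 < poly_weight s l" for l :: "int^'d"
    using infnorm_pos_le[of "lattice_point l"] by (simp add: poly_weight_def)
  define g where "g l = enn2real (E l)" for l
  have E: "E l = ennreal (g l)" for l
  proof -
    have "ennreal (poly_weight s l) * E l < \<infinity>"
      using sum_le[of "{l}"] S by simp
    then have "E l < \<infinity>"
      using weight_pos[of l] by (auto simp: ennreal_mult_less_top)
    then show ?thesis by (simp add: g_def)
  qed
  have g: "0 \<le> g l" for l by (simp add: g_def)
  have fin: "(\<integral>\<^sup>+l. ennreal (poly_weight s l * g l) \<partial>count_space UNIV) < \<infinity>"
  proof -
    have nn: "0 \<le> poly_weight s l * g l" for l
      using g[of l] weight_pos[of l] by simp
    have "(\<Sum>l\<in>F. norm (poly_weight s l * g l)) \<le> enn2real S" if "finite F" for F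
    proof -
      have "ennreal (\<Sum>l\<in>F. poly_weight s l * g l) \<le> S"
        using sum_le[OF that] nn weight_pos g
        by (simp add: E ennreal_mult'[symmetric] less_imp_le)
      then have "(\<Sum>l\<in>F. poly_weight s l * g l) \<le> enn2real S"
        using S by (cases S) (auto simp: sum_nonneg nn)
      then show ?thesis
        using nn by simp
    qed
    then have "Infinite_Set_Sum.abs_summable_on (\<lambda>l. poly_weight s l * g l) UNIV"
      by (intro abs_summable_finite_sumsI)
    then have "integrable (count_space UNIV) (\<lambda>l. poly_weight s l * g l)"
      by (simp add: Infinite_Set_Sum.abs_summable_on_def)
    then show ?thesis
      unfolding integrable_iff_bounded using nn by (simp only: real_norm_def abs_of_nonneg)
  qed
  have bound: "norm (\<phi> (z + lattice_point l)) \<le> g l" if z: "z \<in> cbox 0 1" for z l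
  proof (rule ccontr)
    assume not_le: "\<not> norm (\<phi> (z + lattice_point l)) \<le> g l"
    define T where "T = {z. g l < norm (\<phi> (z + lattice_point l))}"
    have "open T"
      unfolding T_def
      by (intro open_Collect_less continuous_intros continuous_on_compose2[OF cont]) auto
    moreover have "z \<in> T"
      using not_le by (simp add: T_def)
    moreover have "z \<in> closure (box 0 1)"
      using z by (subst closure_box) (auto simp: interval_ne_empty_cart)
    ultimately have "T \<inter> box 0 1 \<noteq> {}"
      by (metis IntI closure_iff_nhds_not_empty inf_commute order_refl)
    then have "\<not> negligible (T \<inter> box 0 1)"
      using \<open>open T\<close> by (intro open_not_negligible open_Int open_box)
    moreover have "negligible (T \<inter> box 0 1)"
    proof -
      have "AE z in lebesgue_on (cbox 0 1). ennreal (norm (\<phi> (z + lattice_point l))) \<le> E l"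
        unfolding E_def by (rule esssup_AE)
      then have "AE z in lebesgue. z \<in> cbox 0 1 \<longrightarrow> ennreal (norm (\<phi> (z + lattice_point l))) \<le> E l"
        by (simp add: AE_restrict_space_iff)
      then obtain N where N: "N \<in> null_sets lebesgue"
        "{z. \<not> (z \<in> cbox 0 1 \<longrightarrow> ennreal (norm (\<phi> (z + lattice_point l))) \<le> E l)} \<subseteq> N"
        by (auto simp: eventually_ae_filter)
      have "T \<inter> box 0 1 \<subseteq> N"
        using N(2) g[of l] box_subset_cbox[of 0 "1::real^'d"] by (auto simp: T_def E)
      then show ?thesis
        using N(1) by (metis negligible_iff_null_sets negligible_subset)
    qed
    ultimately show False by blast
  qed
  show ?thesis
    by (rule that[OF g fin bound])
qed

definition lattice_floor :: "real^'d \<Rightarrow> int^'d" where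
  "lattice_floor z = (\<chi> i. \<lfloor>z $ i\<rfloor>)"

lemma lattice_floor_remainder: "z - lattice_point (lattice_floor z) \<in> cbox 0 1"
  by (auto simp: mem_box_cart lattice_floor_def lattice_point_def) linarith

text \<open>
  Cut a unit cube into \<open>m ^ d\<close> cells of side \<open>1 / m\<close>, smaller than the separation. Each cell contains
  at most one point, so the number of points in the unit cube is at most the number of cells.
\<close>

lemma separated_imp_bounded_multiplicity:
  fixes x :: "int^'d \<Rightarrow> real^'d"
  assumes "separated x"
  obtains D where "0 < D"
    "\<And>n. emeasure (count_space UNIV) {j. lattice_floor (x j) = n} \<le> ennreal D"
proof -
  define \<delta> where "\<delta> = (INF (j, k) \<in> {(j, k). j \<noteq> k}. infnorm (x j - x k))"
  have \<delta>: "0 < \<delta>" using assms by (simp add: separated_def \<delta>_def)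
  have sep: "\<delta> \<le> infnorm (x j - x k)" if "j \<noteq> k" for j k
    using that unfolding \<delta>_def
    by (intro cINF_lower2[of _ _ "(j, k)"] bdd_belowI2[of _ 0]) (auto simp: infnorm_pos_le)
  obtain m :: nat where m: "0 < m" "inverse (real m) < \<delta>"
    using \<delta> by (metis ex_inverse_of_nat_less)
  define Q :: "(int^'d) set" where "Q = {v. \<forall>i. v $ i \<in> {0..<int m}}"
  have "Q \<subseteq> vec_lambda ` (PiE UNIV (\<lambda>_. {0..<int m}))"
  proof
    fix v assume "v \<in> Q"
    then show "v \<in> vec_lambda ` (PiE UNIV (\<lambda>_. {0..<int m}))"
      by (intro image_eqI[of _ _ "vec_nth v"]) (auto simp: Q_def)
  qed
  then have Q: "finite Q"
    by (rule finite_subset) (intro finite_imageI finite_PiE, auto)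
  have "emeasure (count_space UNIV) {j. lattice_floor (x j) = n} \<le> ennreal (1 + real (card Q))" for n
  proof -
    define J where "J = {j. lattice_floor (x j) = n}"
    \<comment> \<open>The index of the small cell that contains \<open>x j\<close>, relative to the corner \<open>n\<close> of the unit cube.\<close>
    define r where "r j = (\<chi> i. \<lfloor>real m * x j $ i\<rfloor> - int m * n $ i)" for j
    have r: "r j \<in> Q" if "j \<in> J" for j
    proof -
      have "int m * n $ i \<le> \<lfloor>real m * x j $ i\<rfloor> \<and> \<lfloor>real m * x j $ i\<rfloor> < int m * n $ i + int m" for i
      proof -
        have "n $ i = \<lfloor>x j $ i\<rfloor>"
          using that by (auto simp: J_def lattice_floor_def)
        then have "real_of_int (n $ i) \<le> x j $ i" "x j $ i < real_of_int (n $ i) + 1"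
          by linarith+
        then have "real m * real_of_int (n $ i) \<le> real m * x j $ i"
          "real m * x j $ i < real m * (real_of_int (n $ i) + 1)"
          using m by (auto intro!: mult_left_mono)
        then show ?thesis
          by (auto simp: le_floor_iff floor_less_iff distrib_left)
      qed
      then show ?thesis
        by (auto simp: Q_def r_def algebra_simps)
    qed
    have inj: "inj_on r J"
    proof (rule inj_onI, rule ccontr)
      fix j k assume "r j = r k" "j \<noteq> k"
      have "\<bar>(x j - x k) $ i\<bar> \<le> inverse (real m)" for i
      proof -
        have "\<lfloor>real m * x j $ i\<rfloor> = \<lfloor>real m * x k $ i\<rfloor>"
          using \<open>r j = r k\<close> by (simp add: r_def vec_eq_iff)
        then have "\<bar>real m * x j $ i - real m * x k $ i\<bar> \<le> 1"
          by linarith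
        then have "real m * \<bar>(x j - x k) $ i\<bar> \<le> 1"
          by (simp add: right_diff_distrib[symmetric] abs_mult)
        then show ?thesis
          using m by (simp add: field_simps)
      qed
      then have "infnorm (x j - x k) \<le> inverse (real m)"
        unfolding infnorm_cart by (intro cSup_least) auto
      with sep[OF \<open>j \<noteq> k\<close>] m show False by simp
    qed
    have "finite J" "card J \<le> card Q"
      using inj r Q by (auto intro: inj_on_finite card_inj_on_le)
    then have "emeasure (count_space UNIV) J = ennreal (real (card J))"
      by (simp add: ennreal_of_nat_eq_real_of_nat)
    also have "\<dots> \<le> ennreal (1 + real (card Q))"
      using \<open>card J \<le> card Q\<close> by (intro ennreal_leI) simp
    finally show ?thesis
      by (simp add: J_def)
  qed
  then show ?thesis
    by (intro that[of "1 + real (card Q)"]) auto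
qed

theorem theorem3p5:
  fixes s :: real
    and \<phi> :: "real ^ 'd \<Rightarrow> complex"
    and x :: "int ^ 'd \<Rightarrow> real ^ 'd"
    and p :: ennreal
  assumes "s > (real CARD('d) + 1)\<^sup>2"
    and "\<phi> \<in> wiener_amalgam (poly_weight s)"
    and "continuous_on UNIV \<phi>"
    and "\<forall>q. admissible_exponent q \<longrightarrow>
           (\<exists>m M :: real. m > 0 \<and> M > 0 \<and>
             (\<forall>c \<in> seq_space q.
                ennreal m * seq_norm q c \<le> Lp_norm lebesgue q (synthesis (shifts \<phi>) c) \<and>
                Lp_norm lebesgue q (synthesis (shifts \<phi>) c) \<le> ennreal M * seq_norm q c))"
    and "separated x"
    and "admissible_exponent p"
    and "\<exists>a b :: real. a > 0 \<and> b > 0 \<and>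
           (\<forall>f \<in> V_space p (shifts \<phi>).
              ennreal a * Lp_norm lebesgue p f \<le> seq_norm p (\<lambda>j. f (x j)) \<and>
              seq_norm p (\<lambda>j. f (x j)) \<le> ennreal b * Lp_norm lebesgue p f)"
  shows "\<forall>q. admissible_exponent q \<longrightarrow> stable_sampling_set q (shifts \<phi>) x"
proof (intro allI impI)
  fix q assume q: "admissible_exponent q"
  obtain g :: "int^'d \<Rightarrow> real" where g: "\<And>l. 0 \<le> g l"
    "(\<integral>\<^sup>+l. ennreal (poly_weight s l * g l) \<partial>count_space UNIV) < \<infinity>"
    and bound: "\<And>l z. z \<in> cbox 0 1 \<Longrightarrow> norm (\<phi> (z + lattice_point l)) \<le> g l"
    using wiener_envelope[OF assms(2,3)] by blast
  obtain D where D: "0 < D"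
    "\<And>n. emeasure (count_space UNIV) {j. lattice_floor (x j) = n} \<le> ennreal D"
    using separated_imp_bounded_multiplicity[OF assms(5)] by blast
  \<comment> \<open>The row of the sample at \<open>x j\<close> is centred at the lower corner of the unit lattice cube around \<open>x j\<close>.\<close>
  interpret localized_matrix "\<lambda>j k. shifts \<phi> k (x j)" "\<lambda>j. lattice_floor (x j)" g s D
  proof
    have "real CARD('d) \<le> (real CARD('d) + 1)\<^sup>2"
      by (simp add: power2_eq_square algebra_simps)
    then show "real CARD('d) < s" using assms(1) by linarith
    show "norm (shifts \<phi> k (x j)) \<le> g (lattice_floor (x j) - k)" for j k
      using bound[OF lattice_floor_remainder, of "x j" "lattice_floor (x j) - k"]
      by (simp add: shifts_def lattice_point_diff)
  qed (use g D in auto)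
  have sampling: "apply_matrix c = sampling_operator (shifts \<phi>) x c" for c
    by (simp add: fun_eq_iff apply_matrix_def sampling_operator_def)
  obtain m where m: "0 < m" "\<And>c. c \<in> seq_space p \<Longrightarrow>
      ennreal m * seq_norm p c \<le> Lp_norm lebesgue p (synthesis (shifts \<phi>) c)"
    using assms(4,6) by blast
  obtain a where a: "0 < a" "\<And>f. f \<in> V_space p (shifts \<phi>) \<Longrightarrow>
      ennreal a * Lp_norm lebesgue p f \<le> seq_norm p (\<lambda>j. f (x j))"
    using assms(7) by blast
  have below: "seq_norm p c \<le> ennreal (1 / (a * m)) * seq_norm p (apply_matrix c)"
    if c: "c \<in> seq_space p" for c
  proof -
    have "ennreal (a * m) * seq_norm p c \<le> ennreal a * Lp_norm lebesgue p (synthesis (shifts \<phi>) c)"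
      using m(2)[OF c] a(1) by (simp add: ennreal_mult' mult.assoc mult_left_mono)
    also have "\<dots> \<le> seq_norm p (\<lambda>j. synthesis (shifts \<phi>) c (x j))"
      using c by (intro a(2)) (simp add: V_space_def)
    also have "(\<lambda>j. synthesis (shifts \<phi>) c (x j)) = apply_matrix c"
      by (simp add: fun_eq_iff synthesis_def apply_matrix_def)
    finally have "ennreal (1 / (a * m)) * (ennreal (a * m) * seq_norm p c)
        \<le> ennreal (1 / (a * m)) * seq_norm p (apply_matrix c)"
      by (rule mult_left_mono) simp
    moreover have "ennreal (1 / (a * m)) * ennreal (a * m) = 1"
      using a m by (simp add: ennreal_mult'[symmetric])
    ultimately show ?thesis
      by (simp add: mult.assoc[symmetric])
  qed
  obtain K where K: "0 < K" "\<And>c B. (\<And>k. norm (c k) \<le> B) \<Longrightarrow>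
      seq_norm q (apply_matrix c) \<le> ennreal K * seq_norm q c"
    using matrix_bounded q by metis
  obtain L where L: "0 < L" "\<And>c. c \<in> seq_space q \<Longrightarrow>
      seq_norm q c \<le> ennreal L * seq_norm q (apply_matrix c)"
    using lower_bound_transfer[OF assms(6) _ below] a m q by (metis divide_pos_pos mult_pos_pos zero_less_one)
  show "stable_sampling_set q (shifts \<phi>) x"
    unfolding stable_sampling_set_def sampling[symmetric]
  proof (intro conjI ballI allI exI)
    fix c :: "int^'d \<Rightarrow> complex" assume c: "c \<in> seq_space q"
    obtain B where B: "\<And>k. norm (c k) \<le> B"
      using seq_space_bounded[OF q c] by blast
    show "(\<lambda>k. c k * shifts \<phi> k (x j)) summable_on UNIV" for j
      using B by (rule bounded_row_summable(1))
    show le: "seq_norm q (apply_matrix c) \<le> ennreal K * seq_norm q c"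
      using B by (rule K(2))
    show "apply_matrix c \<in> seq_space q"
    proof (cases "q = 0")
      case True
      then show ?thesis using c apply_matrix_null by (simp add: seq_space_def)
    next
      case False
      then have "ennreal K * seq_norm q c < \<infinity>"
        using c by (simp add: seq_space_def ennreal_mult_less_top)
      then show ?thesis using False le by (auto simp: seq_space_def)
    qed
    have "ennreal (1 / L) * seq_norm q c \<le> ennreal (1 / L) * (ennreal L * seq_norm q (apply_matrix c))"
      by (intro mult_left_mono L(2) c) simp
    moreover have "ennreal (1 / L) * ennreal L = 1"
      using L by (simp add: ennreal_mult'[symmetric])
    ultimately show "ennreal (1 / L) * seq_norm q c \<le> seq_norm q (apply_matrix c)"
      by (simp add: mult.assoc[symmetric])
  qed (use L in simp)
qed

end
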